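(* Consider charging $N$ $d$-level batteries from $\rho^{\otimes N}$ to $\sigma^{\otimes N}$ by a circuit-based procedure with interaction order at most $k$: the interval $[0,T_\sharp]$ is divided into finitely many steps, and during each step the collective Hamiltonian is $\bm H=\sum_{\mu=1}^{s}h_\mu$, $s=\lceil N/k\rceil$, where the $h_\mu$ act on pairwise disjoint sets of at most $k$ batteries (the partition may change from step to step). If the procedure satisfies constraint (C0), then the quantum advantage satisfies $\Gamma_{\rm C0}<\gamma k$, where $\gamma$ is a constant depending only on the single-battery data ($I$, $\rho$, $\sigma$, and the optimal single-battery charging protocol) and not on $N$. When $\rho$ is the ground state and $\sigma$ the maximally excited state of $I$, one may take $\gamma=\pi/2$.
   Context: Each battery is a $d$-level system with internal Hamiltonian $I^{(j)}=\sum_{l=1}^d\lambda_l|l\rangle_j\langle l|_j$, eigenvalues increasing, with $\lambda_d-\lambda_1=2\lambda_d>0$; the total internal Hamiltonian is $\bm I=\sum_j I^{(j)}$. Charging is unitary evolution under the time-dependent Hamiltonian; work is $W=\mathrm{tr}[\bm I(\text{final}-\text{initial})]$. The quantum advantage is $\Gamma=T_\|/T_\sharp$, where $T_\|$ is the optimal time to take $\rho$ to $\sigma$ with a single-battery Hamiltonian $H(t)$ (charging the $N$ batteries in parallel) and $T_\sharp$ the time of the collective protocol taking $\rho^{\otimes N}$ to $\sigma^{\otimes N}$. Constraint (C0): $\frac1{T_\sharp}\int_0^{T_\sharp}\|\bm H\|_{\rm op}dt\le N\,\frac1{T_\|}\int_0^{T_\|}\|H\|_{\rm op}dt$, where $\|\cdot\|_{\rm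 op}$ is the largest singular value. *)

theory Defs
  imports "HOL-Analysis.Analysis"
begin

text \<open>Operators on a finite-dimensional Hilbert space with orthonormal basis indexed by a
finite carrier set B are represented by their matrix entries  A x y  (x, y in B).
Units with hbar = 1.\<close>

type_synonym 'a op = "'a \<Rightarrow> 'a \<Rightarrow> complex"

definition op_mult :: "'a set \<Rightarrow> 'a op \<Rightarrow> 'a op \<Rightarrow> 'a op" where
  "op_mult B A C = (\<lambda>x y. \<Sum>z\<in>B. A x z * C z y)"

definition op_id :: "'a op" where
  "op_id = (\<lambda>x y. if x = y then 1 else 0)"

definition op_adj :: "'a op \<Rightarrow> 'a op" where
  "op_adj A = (\<lambda>x y. cnj (A y x))"

definition eq_on :: "'a set \<Rightarrow> 'a op \<Rightarrow> 'a op \<Rightarrow> bool" where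
  "eq_on B A C \<longleftrightarrow> (\<forall>x\<in>B. \<forall>y\<in>B. A x y = C x y)"

definition hermitian_on :: "'a set \<Rightarrow> 'a op \<Rightarrow> bool" where
  "hermitian_on B A \<longleftrightarrow> (\<forall>x\<in>B. \<forall>y\<in>B. A x y = cnj (A y x))"

definition density_on :: "'a set \<Rightarrow> 'a op \<Rightarrow> bool" where
  "density_on B \<rho> \<longleftrightarrow> hermitian_on B \<rho>
     \<and> (\<forall>v::'a \<Rightarrow> complex. 0 \<le> Re (\<Sum>x\<in>B. \<Sum>y\<in>B. cnj (v x) * \<rho> x y * v y))
     \<and> (\<Sum>x\<in>B. \<rho> x x) = 1"

definition op_norm :: "'a set \<Rightarrow> 'a op \<Rightarrow> real" where
  "op_norm B A = Sup ((\<lambda>v. sqrt (\<Sum>x\<in>B. (cmod (\<Sum>y\<in>B. A x y * v y))\<^sup>2))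
                      ` {v. (\<Sum>y\<in>B. (cmod (v y))\<^sup>2) = 1})"

text \<open>U solves the Schroedinger equation dU/dt = -i H(t) U(t), U(0) = id, on [0,T]
(in integral / Caratheodory form, so that piecewise defined H are allowed).\<close>
definition solves_schroedinger :: "'a set \<Rightarrow> (real \<Rightarrow> 'a op) \<Rightarrow> real \<Rightarrow> (real \<Rightarrow> 'a op) \<Rightarrow> bool" where
  "solves_schroedinger B H T U \<longleftrightarrow>
     (\<forall>t\<in>{0..T}. \<forall>x\<in>B. \<forall>y\<in>B.
        (\<lambda>s. op_mult B (H s) (U s) x y) integrable_on {0..t}
      \<and> U t x y = op_id x y - \<i> * integral {0..t} (\<lambda>s. op_mult B (H s) (U s) x y))"

definition drives :: "'a set \<Rightarrow> (real \<Rightarrow> 'a op) \<Rightarrow> real \<Rightarrow> 'a op \<Rightarrow> 'a op \<Rightarrow> bool" where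
  "drives B H T \<rho> \<sigma> \<longleftrightarrow> 0 \<le> T
     \<and> (\<forall>t\<in>{0..T}. hermitian_on B (H t))
     \<and> (\<forall>x\<in>B. \<forall>y\<in>B. (\<lambda>t. H t x y) absolutely_integrable_on {0..T})
     \<and> (\<lambda>t. op_norm B (H t)) integrable_on {0..T}
     \<and> (\<exists>U. solves_schroedinger B H T U
            \<and> eq_on B \<sigma> (op_mult B (op_mult B (U T) \<rho>) (op_adj (U T))))"

text \<open>Single battery: basis {0,...,d-1} (level l+1 of the paper is index l).\<close>
definition batt :: "nat \<Rightarrow> nat set" where
  "batt d = {..<d}"

definition optimal_single :: "nat \<Rightarrow> nat op \<Rightarrow> nat op \<Rightarrow> real \<Rightarrow> (real \<Rightarrow> nat op) \<Rightarrow> real \<Rightarrow> bool" where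
  "optimal_single d \<rho> \<sigma> E H T \<longleftrightarrow>
     drives (batt d) H T \<rho> \<sigma> \<and> (\<forall>t\<in>{0..T}. op_norm (batt d) (H t) \<le> E)
     \<and> (\<forall>H' T'. drives (batt d) H' T' \<rho> \<sigma> \<and> (\<forall>t\<in>{0..T'}. op_norm (batt d) (H' t) \<le> E)
                \<longrightarrow> T \<le> T')"

definition cfgs :: "nat \<Rightarrow> nat \<Rightarrow> (nat \<Rightarrow> nat) set" where
  "cfgs N d = PiE {..<N} (\<lambda>_. {..<d})"

definition tensor_pow :: "nat \<Rightarrow> nat op \<Rightarrow> (nat \<Rightarrow> nat) op" where
  "tensor_pow N \<rho> = (\<lambda>x y. \<Prod>i<N. \<rho> (x i) (y i))"

text \<open>An operator h on the batteries in S (basis PiE S ...), tensored with identity elsewhere.\<close>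
definition embed :: "nat \<Rightarrow> nat set \<Rightarrow> (nat \<Rightarrow> nat) op \<Rightarrow> (nat \<Rightarrow> nat) op" where
  "embed N S h = (\<lambda>x y. if (\<forall>i\<in>{..<N} - S. x i = y i)
                        then h (restrict x S) (restrict y S) else 0)"

definition circuit_protocol :: "nat \<Rightarrow> nat \<Rightarrow> nat \<Rightarrow> (real \<Rightarrow> (nat \<Rightarrow> nat) op) \<Rightarrow> real
                                  \<Rightarrow> nat op \<Rightarrow> nat op \<Rightarrow> bool" where
  "circuit_protocol d N k Hc T \<rho> \<sigma> \<longleftrightarrow>
     drives (cfgs N d) Hc T (tensor_pow N \<rho>) (tensor_pow N \<sigma>)
     \<and> (\<exists>(m::nat) (tt::nat \<Rightarrow> real) (S::nat \<Rightarrow> nat \<Rightarrow> nat set)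
          (h::nat \<Rightarrow> nat \<Rightarrow> real \<Rightarrow> (nat \<Rightarrow> nat) op).
          tt 0 = 0 \<and> tt m = T \<and> (\<forall>j<m. tt j < tt (Suc j))
        \<and> (\<forall>j<m. \<forall>\<mu><nat \<lceil>real N / real k\<rceil>.
              S j \<mu> \<subseteq> {..<N} \<and> card (S j \<mu>) \<le> k
            \<and> (\<forall>t. hermitian_on (PiE (S j \<mu>) (\<lambda>_. {..<d})) (h j \<mu> t)))
        \<and> (\<forall>j<m. \<forall>\<mu><nat \<lceil>real N / real k\<rceil>. \<forall>\<nu><nat \<lceil>real N / real k\<rceil>.
              \<mu> \<noteq> \<nu> \<longrightarrow> S j \<mu> \<inter> S j \<nu> = {})
        \<and> (\<forall>j<m. \<forall>t. tt j \<le> t \<and> t < tt (Suc j) \<longrightarrow>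
              eq_on (cfgs N d) (Hc t)
                (\<lambda>x y. \<Sum>\<mu><nat \<lceil>real N / real k\<rceil>. embed N (S j \<mu>) (h j \<mu> t) x y)))"

definition C0 :: "nat \<Rightarrow> nat \<Rightarrow> (real \<Rightarrow> (nat \<Rightarrow> nat) op) \<Rightarrow> real \<Rightarrow> (real \<Rightarrow> nat op) \<Rightarrow> real \<Rightarrow> bool" where
  "C0 d N Hc Ts H Tp \<longleftrightarrow>
     (1 / Ts) * integral {0..Ts} (\<lambda>t. op_norm (cfgs N d) (Hc t))
       \<le> real N * ((1 / Tp) * integral {0..Tp} (\<lambda>t. op_norm (batt d) (H t)))"

definition advantage_bounded :: "nat \<Rightarrow> nat op \<Rightarrow> nat op \<Rightarrow> (real \<Rightarrow> nat op) \<Rightarrow> real \<Rightarrow> real \<Rightarrow> bool" where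
  "advantage_bounded d \<rho> \<sigma> H Tp \<gamma> \<longleftrightarrow>
     (\<forall>N k Hc Ts. 1 \<le> N \<longrightarrow> 1 \<le> k \<longrightarrow> circuit_protocol d N k Hc Ts \<rho> \<sigma>
        \<longrightarrow> C0 d N Hc Ts H Tp \<longrightarrow> Tp / Ts < \<gamma> * real k)"

definition proj :: "nat \<Rightarrow> nat op" where
  "proj j = (\<lambda>x y. if x = j \<and> y = j then 1 else 0)"

end

theory Submission
  imports Defs
begin

text \<open>
Fix a hermitian single-battery observable \<open>a\<close> and let \<open>A\<close> be the sum of its copies on the \<open>N\<close>
batteries. A block Hamiltonian \<open>h\<close> commutes with the copies outside its block, so it changes the
expectation of \<open>A\<close> at a rate of at most \<open>k \<parallel>a\<parallel>\<close> times the width of its numerical range. By product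
vectors, the widths over all disjoint blocks add up to at most twice the norm of the collective
Hamiltonian. Hence the total charge \<open>N tr(a (\<sigma> - \<rho>))\<close> is at most \<open>2 k \<parallel>a\<parallel>\<close> times the integral of that
norm, which (C0) bounds by \<open>N E T\<close>; here \<open>E\<close> bounds the single-battery Hamiltonian. Taking
\<open>a = \<sigma> - \<rho>\<close> makes the charge positive. For full charging, \<open>a = |d\<rangle>\<langle>d| - |1\<rangle>\<langle>1|\<close> is used and a rotation in
the plane of these two levels shows that the optimal single-battery time is at most \<open>\<pi>/(2E)\<close>.
\<close>

text \<open>The obstacle is that \<open>Hc\<close> does not determine the block operators: multiples
  of the identity can be moved between blocks, so the norms of the single blocks may be large while
  the norm of their sum is small. The width of the numerical range is invariant under such shifts,
  and it is all that the rate of change of an expectation value can feel. The energy gain can vanish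
  between distinct states. The observable \<open>\<sigma> - \<rho>\<close> avoids this: its charge
  is the squared Hilbert-Schmidt norm of \<open>\<sigma> - \<rho>\<close>, which is zero only if the
  states agree, and then the optimal time is zero. The constant pi/2 arises as follows. The
  observable for full charging has norm at most 1 and rises from -1 to 1 on each battery, so 2N <=
  2k times the integrated norm; (C0) turns this into 1 <= k E \<open>Ts\<close>, and E
  \<open>Tp\<close> <= pi/2. Strictness is a separate matter: the general constant has room for an
  added 1, but pi/2 leaves no slack, so there the charge inequality itself must be strict. The
  all-ground product state supplies this, because the charging power starts from zero.\<close>

section \<open>Vectors and operators on a finite basis\<close>

definition vip :: "'a set \<Rightarrow> ('a \<Rightarrow> complex) \<Rightarrow> ('a \<Rightarrow> complex) \<Rightarrow> complex" where
  "vip B u v = (\<Sum>x\<in>B. cnj (u x) * v x)"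

definition vnorm :: "'a set \<Rightarrow> ('a \<Rightarrow> complex) \<Rightarrow> real" where
  "vnorm B v = L2_set (\<lambda>x. cmod (v x)) B"

definition app :: "'a set \<Rightarrow> 'a op \<Rightarrow> ('a \<Rightarrow> complex) \<Rightarrow> 'a \<Rightarrow> complex" where
  "app B A v = (\<lambda>x. \<Sum>y\<in>B. A x y * v y)"

lemma vnorm_nonneg [simp]: "0 \<le> vnorm B v"
  by (simp add: vnorm_def)

lemma vnorm_sq: "(vnorm B v)\<^sup>2 = (\<Sum>x\<in>B. (cmod (v x))\<^sup>2)"
  by (simp add: vnorm_def L2_set_def sum_nonneg)

lemma vip_self: "vip B v v = of_real ((vnorm B v)\<^sup>2)"
proof -
  have "cnj z * z = of_real ((cmod z)\<^sup>2)" for z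
    by (metis complex_norm_square mult.commute)
  then show ?thesis by (simp add: vip_def vnorm_sq)
qed

lemma vip_add_left: "vip B (\<lambda>x. u x + v x) w = vip B u w + vip B v w"
  by (simp add: vip_def algebra_simps sum.distrib)

lemma vip_add_right: "vip B w (\<lambda>x. u x + v x) = vip B w u + vip B w v"
  by (simp add: vip_def algebra_simps sum.distrib)

lemma vip_diff_right: "vip B w (\<lambda>x. u x - v x) = vip B w u - vip B w v"
  by (simp add: vip_def algebra_simps sum_subtractf)

lemma vip_scale_left: "vip B (\<lambda>x. c * u x) w = cnj c * vip B u w"
  by (simp add: vip_def sum_distrib_left mult.assoc)

lemma vip_scale_right: "vip B w (\<lambda>x. c * u x) = c * vip B w u"
  by (simp add: vip_def sum_distrib_left mult_ac)

lemma vip_sum_left: "vip B (\<lambda>x. \<Sum>i\<in>I. u i x) w = (\<Sum>i\<in>I. vip B (u i) w)"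
  by (simp add: vip_def sum_distrib_right cnj_sum, rule sum.swap)

lemma vip_sum_right: "vip B w (\<lambda>x. \<Sum>i\<in>I. u i x) = (\<Sum>i\<in>I. vip B w (u i))"
  by (simp add: vip_def sum_distrib_left, rule sum.swap)

lemma vip_cnj: "cnj (vip B u v) = vip B v u"
  by (simp add: vip_def cnj_sum mult.commute)

lemma vip_cong: "(\<And>x. x \<in> B \<Longrightarrow> u x = u' x) \<Longrightarrow> (\<And>x. x \<in> B \<Longrightarrow> v x = v' x) \<Longrightarrow> vip B u v = vip B u' v'"
  by (simp add: vip_def)

lemma vnorm_cong: "(\<And>x. x \<in> B \<Longrightarrow> u x = u' x) \<Longrightarrow> vnorm B u = vnorm B u'"
  by (simp add: vnorm_def L2_set_def)

lemma app_cong: "(\<And>y. y \<in> B \<Longrightarrow> A x y = A' x y) \<Longrightarrow> (\<And>y. y \<in> B \<Longrightarrow> v y = v' y) \<Longrightarrow> app B A v x = app B A' v' x"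
  by (simp add: app_def)

lemma norm_vip_le: "cmod (vip B u v) \<le> vnorm B u * vnorm B v"
proof -
  have "cmod (vip B u v) \<le> (\<Sum>x\<in>B. cmod (u x) * cmod (v x))"
    unfolding vip_def by (rule order_trans[OF norm_sum]) (simp add: norm_mult)
  also have "\<dots> \<le> vnorm B u * vnorm B v"
    using L2_set_mult_ineq[of "\<lambda>x. cmod (u x)" "\<lambda>x. cmod (v x)" B] by (simp add: vnorm_def)
  finally show ?thesis .
qed

lemma vnorm_add_le: "vnorm B (\<lambda>x. u x + v x) \<le> vnorm B u + vnorm B v"
proof -
  have "vnorm B (\<lambda>x. u x + v x) \<le> L2_set (\<lambda>x. cmod (u x) + cmod (v x)) B"
    unfolding vnorm_def by (rule L2_set_mono) (auto intro: norm_triangle_ineq)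
  also have "\<dots> \<le> vnorm B u + vnorm B v"
    unfolding vnorm_def by (rule L2_set_triangle_ineq)
  finally show ?thesis .
qed

lemma vnorm_sum_le: "vnorm B (\<lambda>x. \<Sum>i\<in>I. u i x) \<le> (\<Sum>i\<in>I. vnorm B (u i))"
proof (induction I rule: infinite_finite_induct)
  case (insert i I)
  then show ?case
    using vnorm_add_le[of B "u i" "\<lambda>x. \<Sum>i\<in>I. u i x"] by auto
qed (auto simp: vnorm_def L2_set_def)

lemma vnorm_scale: "vnorm B (\<lambda>x. c * v x) = cmod c * vnorm B v"
  by (simp add: vnorm_def norm_mult L2_set_right_distrib)

lemma vnorm_le_sum: "vnorm B v \<le> (\<Sum>x\<in>B. cmod (v x))"
  unfolding vnorm_def by (rule L2_set_le_sum) auto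

lemma norm_le_vnorm: "finite B \<Longrightarrow> x \<in> B \<Longrightarrow> cmod (v x) \<le> vnorm B v"
  unfolding vnorm_def by (rule member_le_L2_set)

lemma app_add: "app B A (\<lambda>x. u x + v x) = (\<lambda>x. app B A u x + app B A v x)"
  by (simp add: app_def algebra_simps sum.distrib)

lemma app_diff: "app B A (\<lambda>x. u x - v x) = (\<lambda>x. app B A u x - app B A v x)"
  by (simp add: app_def algebra_simps sum_subtractf)

lemma app_scale: "app B A (\<lambda>x. c * v x) = (\<lambda>x. c * app B A v x)"
  by (simp add: app_def sum_distrib_left mult_ac)

lemma app_sum_op: "app B (\<lambda>x y. \<Sum>i\<in>I. A i x y) v = (\<lambda>x. \<Sum>i\<in>I. app B (A i) v x)"
  by (rule ext, simp add: app_def sum_distrib_right, rule sum.swap)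

lemma app_id: "finite B \<Longrightarrow> x \<in> B \<Longrightarrow> app B op_id v x = v x"
  by (simp add: app_def op_id_def if_distrib[of "\<lambda>z. z * _"] sum.delta cong: if_cong)

lemma vip_hermitian:
  assumes "hermitian_on B A"
  shows "vip B u (app B A v) = vip B (app B A u) v"
proof -
  have "vip B u (app B A v) = (\<Sum>x\<in>B. \<Sum>y\<in>B. cnj (u x) * (A x y * v y))"
    by (simp add: vip_def app_def sum_distrib_left)
  also have "\<dots> = (\<Sum>y\<in>B. \<Sum>x\<in>B. cnj (u x) * (A x y * v y))"
    by (rule sum.swap)
  also have "\<dots> = (\<Sum>y\<in>B. \<Sum>x\<in>B. cnj (A y x * u x) * v y)"
  proof (intro sum.cong refl)
    fix x y assume "x \<in> B" "y \<in> B"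
    then have "A x y = cnj (A y x)" using assms unfolding hermitian_on_def by blast
    then show "cnj (u x) * (A x y * v y) = cnj (A y x * u x) * v y" by simp
  qed
  also have "\<dots> = vip B (app B A u) v"
    by (simp add: vip_def app_def sum_distrib_right)
  finally show ?thesis .
qed

lemma Im_vip_hermitian:
  assumes "hermitian_on B A"
  shows "Im (vip B v (app B A v)) = 0"
proof -
  have "cnj (vip B v (app B A v)) = vip B v (app B A v)"
    by (simp add: vip_cnj vip_hermitian[OF assms])
  then show ?thesis by (metis complex_cnj_cancel_iff cnj.simps(2) equal_neg_zero)
qed

text \<open>Crude, but enough to make the supremum in \<open>op_norm\<close> one over a bounded set
  and to settle vectors of length zero.\<close>

lemma app_norm_bound:
  assumes "finite B"
  shows "vnorm B (app B A v) \<le> (\<Sum>x\<in>B. \<Sum>y\<in>B. cmod (A x y)) * vnorm B v"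
proof -
  have "vnorm B (app B A v) \<le> (\<Sum>x\<in>B. cmod (app B A v x))" by (rule vnorm_le_sum)
  also have "\<dots> \<le> (\<Sum>x\<in>B. \<Sum>y\<in>B. cmod (A x y) * vnorm B v)"
    unfolding app_def
    by (intro sum_mono order_trans[OF norm_sum])
       (auto simp: norm_mult intro!: mult_left_mono norm_le_vnorm assms)
  finally show ?thesis by (simp add: sum_distrib_right)
qed

section \<open>Operator norm as a supremum over unit vectors\<close>

lemma op_norm_eq: "op_norm B A = Sup ((\<lambda>v. vnorm B (app B A v)) ` {v. vnorm B v = 1})"
  by (simp add: op_norm_def vnorm_def app_def L2_set_def)

lemma vnorm_app_le:
  assumes "finite B"
  shows "vnorm B (app B A v) \<le> op_norm B A * vnorm B v"
proof (cases "vnorm B v = 0")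
  case True
  with app_norm_bound[OF assms, of A v] show ?thesis by simp
next
  case False
  define c where "c = vnorm B v"
  have c: "c > 0" using False vnorm_nonneg[of B v] unfolding c_def by linarith
  define w where "w = (\<lambda>x. complex_of_real (1/c) * v x)"
  have w1: "vnorm B w = 1" using c unfolding w_def vnorm_scale by (simp add: norm_divide flip: c_def)
  have bdd: "bdd_above ((\<lambda>v. vnorm B (app B A v)) ` {v. vnorm B v = 1})"
    by (rule bdd_aboveI2[where M="\<Sum>x\<in>B. \<Sum>y\<in>B. cmod (A x y)"])
       (use app_norm_bound[OF assms, of A] in \<open>metis mem_Collect_eq mult.right_neutral\<close>)
  have "vnorm B (app B A w) \<le> op_norm B A"
    unfolding op_norm_eq by (rule cSUP_upper[OF _ bdd]) (use w1 in simp)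
  moreover have "vnorm B (app B A w) = vnorm B (app B A v) / c"
    unfolding w_def app_scale vnorm_scale using c by (simp add: norm_divide)
  ultimately show ?thesis using c by (simp add: c_def field_simps)
qed

lemma ex_unit_vector:
  assumes "finite B" "B \<noteq> {}"
  obtains v where "vnorm B v = 1"
proof -
  obtain b where b: "b \<in> B" using assms by blast
  have "vnorm B (\<lambda>x. if x = b then 1 else 0) = 1"
    using assms b by (simp add: vnorm_def L2_set_def if_distrib[of cmod]
        if_distrib[of "\<lambda>r. r\<^sup>2"] sum.delta cong: if_cong)
  then show thesis by (rule that)
qed

lemma op_norm_nonneg:
  assumes "finite B" "B \<noteq> {}"
  shows "0 \<le> op_norm B A"
proof -
  obtain v where "vnorm B v = 1" using ex_unit_vector[OF assms] by blast
  with vnorm_app_le[OF assms(1), of A v] show ?thesis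
    using vnorm_nonneg[of B "app B A v"] by (metis mult.right_neutral order_trans)
qed

lemma op_norm_le:
  assumes "finite B" "B \<noteq> {}" "\<And>v. vnorm B (app B A v) \<le> c * vnorm B v"
  shows "op_norm B A \<le> c"
proof -
  obtain v where "vnorm B v = 1" using ex_unit_vector[OF assms(1,2)] by blast
  then have "{v. vnorm B v = 1} \<noteq> {}" by blast
  then show ?thesis unfolding op_norm_eq
    by (rule cSUP_least) (use assms(3) in \<open>metis mem_Collect_eq mult.right_neutral\<close>)
qed

lemma norm_vip_app_le:
  assumes "finite B"
  shows "cmod (vip B u (app B A v)) \<le> op_norm B A * vnorm B u * vnorm B v"
proof -
  have "cmod (vip B u (app B A v)) \<le> vnorm B u * vnorm B (app B A v)" by (rule norm_vip_le)
  also have "\<dots> \<le> vnorm B u * (op_norm B A * vnorm B v)"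
    by (intro mult_left_mono vnorm_app_le assms) auto
  finally show ?thesis by (simp add: mult_ac)
qed

text \<open>The two vectors \<open>\<phi> \<plusminus> i c u\<close> have the same length, so shifting \<open>K\<close> by a multiple of the
identity does not matter and only the width \<open>M + M'\<close> of the numerical range enters.\<close>
lemma Im_vip_le_width:
  assumes K: "hermitian_on B K" and u: "Im (vip B \<phi> u) = 0"
    and hi: "\<And>\<psi>. Re (vip B \<psi> (app B K \<psi>)) \<le> M * (vnorm B \<psi>)\<^sup>2"
    and lo: "\<And>\<psi>. - Re (vip B \<psi> (app B K \<psi>)) \<le> M' * (vnorm B \<psi>)\<^sup>2"
  shows "2 * Im (vip B u (app B K \<phi>)) \<le> (M + M') * (vnorm B u * vnorm B \<phi>)"
proof (cases "vnorm B u = 0 \<or> vnorm B \<phi> = 0")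
  case True
  have "vip B u (app B K \<phi>) = vip B (app B K u) \<phi>" by (rule vip_hermitian[OF K])
  then have "cmod (vip B u (app B K \<phi>)) \<le> vnorm B u * vnorm B (app B K \<phi>)"
    "cmod (vip B u (app B K \<phi>)) \<le> vnorm B (app B K u) * vnorm B \<phi>"
    using norm_vip_le[of B u "app B K \<phi>"] norm_vip_le[of B "app B K u" \<phi>] by auto
  with True have "vip B u (app B K \<phi>) = 0" by auto
  with True show ?thesis by auto
next
  case False
  \<comment> \<open>This scaling gives \<open>c * u\<close> the length of \<open>\<phi>\<close>,
    which minimises the quotient of
    \<open>(vnorm B \<phi>)\<^sup>2 + c\<^sup>2 * (vnorm B u)\<^sup>2\<close> by \<open>c\<close>
    that bounds the cross term.\<close>
  define c where "c = vnorm B \<phi> / vnorm B u"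
  have up: "vnorm B u > 0" and pp: "vnorm B \<phi> > 0"
    using False vnorm_nonneg[of B u] vnorm_nonneg[of B \<phi>] by linarith+
  then have c: "c > 0" by (simp add: c_def)
  define z where "z = (\<lambda>e::real. \<i> * complex_of_real (e * c))"
  have z: "Re (z e) = 0" "Im (z e) = e * c" for e by (simp_all add: z_def)
  define p where "p = (\<lambda>e x. \<phi> x + z e * u x)"
  have q: "Re (vip B (p e) (app B K (p e))) = Re (vip B \<phi> (app B K \<phi>))
       + (e*c)\<^sup>2 * Re (vip B u (app B K u)) + 2 * (e*c) * Im (vip B u (app B K \<phi>))" for e
  proof -
    have *: "vip B \<phi> (app B K u) = cnj (vip B u (app B K \<phi>))"
      by (simp add: vip_cnj vip_hermitian[OF K])
    show ?thesis
      unfolding p_def app_add app_scale vip_add_left vip_add_right vip_scale_left vip_scale_right *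
      by (simp add: z algebra_simps power2_eq_square)
  qed
  have n: "(vnorm B (p e))\<^sup>2 = (vnorm B \<phi>)\<^sup>2 + (e*c)\<^sup>2 * (vnorm B u)\<^sup>2" for e
  proof -
    have *: "vip B u \<phi> = cnj (vip B \<phi> u)" by (simp add: vip_cnj)
    have "Re (vip B (p e) (p e)) = Re (vip B \<phi> \<phi>) + (e*c)\<^sup>2 * Re (vip B u u)"
      unfolding p_def vip_add_left vip_add_right vip_scale_left vip_scale_right *
      using u by (simp add: z algebra_simps power2_eq_square)
    then show ?thesis by (simp add: vip_self)
  qed
  \<comment> \<open>Adding \<open>hi\<close> for the sign +1 and \<open>lo\<close> for the sign -1
    cancels the two diagonal terms and doubles the cross term.\<close>
  have "4 * c * Im (vip B u (app B K \<phi>)) \<le> (M + M') * ((vnorm B \<phi>)\<^sup>2 + c\<^sup>2 * (vnorm B u)\<^sup>2)"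
    using hi[of "p 1"] lo[of "p (-1)"] unfolding q n by (simp add: algebra_simps)
  also have "c\<^sup>2 * (vnorm B u)\<^sup>2 = (vnorm B \<phi>)\<^sup>2"
    using up by (simp add: c_def power_divide)
  finally have "4 * c * Im (vip B u (app B K \<phi>)) \<le> (M + M') * (2 * (vnorm B \<phi>)\<^sup>2)" by simp
  then have "4 * vnorm B \<phi> * Im (vip B u (app B K \<phi>)) \<le> (M + M') * (2 * (vnorm B \<phi>)\<^sup>2) * vnorm B u"
    using up by (simp add: c_def field_simps)
  then have "2 * vnorm B \<phi> * (2 * Im (vip B u (app B K \<phi>)))
      \<le> 2 * vnorm B \<phi> * ((M + M') * (vnorm B u * vnorm B \<phi>))"
    by (simp add: algebra_simps power2_eq_square)
  then show ?thesis by (rule mult_left_le_imp_le) (use pp in simp)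
qed

section \<open>Block operators\<close>

abbreviation cf :: "nat \<Rightarrow> nat set \<Rightarrow> (nat \<Rightarrow> nat) set" where
  "cf d S \<equiv> PiE S (\<lambda>_. {..<d})"

lemma finite_cf [simp]: "finite S \<Longrightarrow> finite (cf d S)"
  by (simp add: finite_PiE)

lemma finite_cfgs [simp]: "finite (cfgs N d)"
  by (simp add: cfgs_def)

lemma cf_nonempty: "0 < d \<Longrightarrow> cf d S \<noteq> {}"
  by (auto simp: PiE_eq_empty_iff)

lemma override_on_cf: "x \<in> cf d X \<Longrightarrow> z \<in> cf d S \<Longrightarrow> S \<subseteq> X \<Longrightarrow> override_on x z S \<in> cf d X"
  by (auto simp: override_on_def PiE_iff extensional_def)

lemma restrict_override_on: "z \<in> cf d S \<Longrightarrow> restrict (override_on x z S) S = z"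
  by (rule ext) (auto simp: override_on_def PiE_iff extensional_def restrict_def)

lemma override_on_override_on: "override_on (override_on x z S) z' S = override_on x z' S"
  by (auto simp: override_on_def)

text \<open>A configuration on \<open>X\<close> is a pair of a configuration outside
  \<open>S\<close> and one on \<open>S\<close>, glued by \<open>override_on\<close>.\<close>

lemma sum_cf_split:
  assumes "S \<subseteq> X"
  shows "(\<Sum>x\<in>cf d X. F x) = (\<Sum>w\<in>cf d (X - S). \<Sum>z\<in>cf d S. F (override_on w z S))"
proof -
  have "(\<Sum>x\<in>cf d X. F x) = (\<Sum>(w,z)\<in>cf d (X - S) \<times> cf d S. F (override_on w z S))"
  proof (rule sum.reindex_bij_witness[where i="\<lambda>(w,z). override_on w z S"
          and j="\<lambda>x. (restrict x (X - S), restrict x S)"])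
    fix x assume x: "x \<in> cf d X"
    have *: "override_on (restrict x (X - S)) (restrict x S) S = x"
      using x assms by (auto simp: override_on_def PiE_iff extensional_def fun_eq_iff)
    then show "(case (restrict x (X - S), restrict x S) of (w, z) \<Rightarrow> override_on w z S) = x"
      "(case (restrict x (X - S), restrict x S) of (w, z) \<Rightarrow> F (override_on w z S)) = F x"
      by simp_all
  qed (use assms in \<open>auto simp: override_on_def PiE_iff extensional_def fun_eq_iff\<close>)
  then show ?thesis by (simp add: sum.cartesian_product)
qed

lemma app_embed:
  assumes "S \<subseteq> {..<N}" "x \<in> cfgs N d"
  shows "app (cfgs N d) (embed N S h) \<phi> x = (\<Sum>z\<in>cf d S. h (restrict x S) z * \<phi> (override_on x z S))"
proof -
  let ?P = "{y \<in> cfgs N d. \<forall>i\<in>{..<N} - S. x i = y i}"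
  have "app (cfgs N d) (embed N S h) \<phi> x
      = (\<Sum>y\<in>cfgs N d. if \<forall>i\<in>{..<N} - S. x i = y i then h (restrict x S) (restrict y S) * \<phi> y else 0)"
    unfolding app_def embed_def by (intro sum.cong) auto
  also have "\<dots> = (\<Sum>y\<in>?P. h (restrict x S) (restrict y S) * \<phi> y)"
    by (simp add: sum.inter_filter)
  also have "\<dots> = (\<Sum>z\<in>cf d S. h (restrict x S) z * \<phi> (override_on x z S))"
  proof (rule sum.reindex_bij_witness[where i="\<lambda>z. override_on x z S" and j="\<lambda>y. restrict y S"])
    fix y assume y: "y \<in> ?P"
    show "override_on x (restrict y S) S = y"
    proof
      fix i
      show "override_on x (restrict y S) S i = y i"
        using y assms by (cases "i < N") (auto simp: cfgs_def override_on_def PiE_iff extensional_def)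
    qed
    then show "h (restrict x S) (restrict y S) * \<phi> (override_on x (restrict y S) S)
        = h (restrict x S) (restrict y S) * \<phi> y" by simp
    show "restrict y S \<in> cf d S" using y assms by (auto simp: cfgs_def PiE_iff)
  next
    fix z assume z: "z \<in> cf d S"
    show "restrict (override_on x z S) S = z" by (rule restrict_override_on[OF z])
    show "override_on x z S \<in> ?P"
      using override_on_cf[of x "{..<N}" d z S] z assms by (auto simp: cfgs_def override_on_def)
  qed
  finally show ?thesis .
qed

text \<open>With the configuration \<open>w\<close> outside \<open>S\<close> frozen, the embedded
  operator acts on the remaining slice of \<open>\<phi>\<close> as \<open>h\<close> itself. The free
  \<open>G\<close> serves both the squared length of the image and the quadratic form.\<close>

lemma sum_embed_slices:
  assumes "S \<subseteq> {..<N}"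
  shows "(\<Sum>x\<in>cfgs N d. G (\<phi> x) (app (cfgs N d) (embed N S h) \<phi> x))
    = (\<Sum>w\<in>cf d ({..<N} - S). \<Sum>z\<in>cf d S.
        G (\<phi> (override_on w z S)) (app (cf d S) h (\<lambda>z. \<phi> (override_on w z S)) z))"
proof -
  have "app (cfgs N d) (embed N S h) \<phi> (override_on w z S) = app (cf d S) h (\<lambda>z. \<phi> (override_on w z S)) z"
    if "w \<in> cf d ({..<N} - S)" "z \<in> cf d S" for w z
  proof -
    have "override_on w z S \<in> cfgs N d"
      using that assms by (auto simp: cfgs_def override_on_def PiE_iff extensional_def)
    then show ?thesis
      by (subst app_embed[OF assms])
         (simp_all add: restrict_override_on[OF that(2)] override_on_override_on app_def)
  qed
  then show ?thesis
    unfolding cfgs_def by (subst sum_cf_split[OF assms]) (simp add: cfgs_def)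
qed

lemma vnorm_slices:
  assumes "S \<subseteq> {..<N}"
  shows "(vnorm (cfgs N d) \<phi>)\<^sup>2 = (\<Sum>w\<in>cf d ({..<N} - S). (vnorm (cf d S) (\<lambda>z. \<phi> (override_on w z S)))\<^sup>2)"
  unfolding vnorm_sq cfgs_def by (subst sum_cf_split[OF assms]) simp

lemma vip_embed_slices:
  assumes "S \<subseteq> {..<N}"
  shows "vip (cfgs N d) \<phi> (app (cfgs N d) (embed N S h) \<phi>)
    = (\<Sum>w\<in>cf d ({..<N} - S). vip (cf d S) (\<lambda>z. \<phi> (override_on w z S))
          (app (cf d S) h (\<lambda>z. \<phi> (override_on w z S))))"
  unfolding vip_def using sum_embed_slices[OF assms, where G="\<lambda>a b. cnj a * b"] by simp

lemma vnorm_embed_le: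
  assumes "S \<subseteq> {..<N}" "0 \<le> \<alpha>" "\<And>v. vnorm (cf d S) (app (cf d S) h v) \<le> \<alpha> * vnorm (cf d S) v"
  shows "vnorm (cfgs N d) (app (cfgs N d) (embed N S h) \<phi>) \<le> \<alpha> * vnorm (cfgs N d) \<phi>"
proof -
  have "(vnorm (cfgs N d) (app (cfgs N d) (embed N S h) \<phi>))\<^sup>2
     = (\<Sum>w\<in>cf d ({..<N} - S). (vnorm (cf d S) (app (cf d S) h (\<lambda>z. \<phi> (override_on w z S))))\<^sup>2)"
    unfolding vnorm_sq using sum_embed_slices[OF assms(1), where G="\<lambda>a b. (cmod b)\<^sup>2"] by simp
  also have "\<dots> \<le> (\<Sum>w\<in>cf d ({..<N} - S). \<alpha>\<^sup>2 * (vnorm (cf d S) (\<lambda>z. \<phi> (override_on w z S)))\<^sup>2)"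
    by (intro sum_mono) (simp add: assms(3) power_mono flip: power_mult_distrib)
  also have "\<dots> = (\<alpha> * vnorm (cfgs N d) \<phi>)\<^sup>2"
    by (simp add: sum_distrib_left vnorm_slices[OF assms(1)] power_mult_distrib)
  finally show ?thesis
    by (rule power2_le_imp_le) (simp add: assms)
qed

lemma hermitian_embed:
  assumes "S \<subseteq> {..<N}" "hermitian_on (cf d S) h"
  shows "hermitian_on (cfgs N d) (embed N S h)"
  unfolding hermitian_on_def
proof (intro ballI)
  fix x y assume "x \<in> cfgs N d" "y \<in> cfgs N d"
  then have "restrict x S \<in> cf d S" "restrict y S \<in> cf d S"
    using assms(1) by (auto simp: cfgs_def PiE_iff)
  then have "h (restrict x S) (restrict y S) = cnj (h (restrict y S) (restrict x S))"
    using assms(2) unfolding hermitian_on_def by blast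
  then show "embed N S h x y = cnj (embed N S h y x)"
    by (auto simp: embed_def)
qed

text \<open>The two operators overwrite disjoint sets of coordinates and neither reads those of the
  other, so both orders give the same double sum.\<close>

lemma embed_commute:
  assumes "S \<subseteq> {..<N}" "R \<subseteq> {..<N}" "S \<inter> R = {}" "x \<in> cfgs N d"
  shows "app (cfgs N d) (embed N S h) (app (cfgs N d) (embed N R g) \<phi>) x
       = app (cfgs N d) (embed N R g) (app (cfgs N d) (embed N S h) \<phi>) x"
proof -
  have ov: "override_on x z S \<in> cfgs N d" if "z \<in> cf d S" "S \<subseteq> {..<N}" for z S
    using override_on_cf[of x "{..<N}" d z S] that assms(4) by (simp add: cfgs_def)
  have r1: "restrict (override_on x z S) R = restrict x R"
   and r2: "restrict (override_on x z R) S = restrict x S"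
   and c: "override_on (override_on x z S) z' R = override_on (override_on x z' R) z S" for z z'
    using assms(3) by (auto simp: override_on_def restrict_def fun_eq_iff)
  have "app (cfgs N d) (embed N S h) (app (cfgs N d) (embed N R g) \<phi>) x
    = (\<Sum>z\<in>cf d S. \<Sum>z'\<in>cf d R. h (restrict x S) z * (g (restrict x R) z' * \<phi> (override_on (override_on x z S) z' R)))"
    by (simp add: app_embed assms ov r1 sum_distrib_left)
  also have "\<dots> = (\<Sum>z'\<in>cf d R. \<Sum>z\<in>cf d S. h (restrict x S) z * (g (restrict x R) z' * \<phi> (override_on (override_on x z S) z' R)))"
    by (rule sum.swap)
  also have "\<dots> = app (cfgs N d) (embed N R g) (app (cfgs N d) (embed N S h) \<phi>) x"
    by (simp add: app_embed assms ov r2 sum_distrib_left c mult.left_commute)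
  finally show ?thesis .
qed

text \<open>For hermitian \<open>h\<close> this is the largest eigenvalue in its variational form.
  The smallest one is minus the \<open>top_val\<close> of \<open>-h\<close>, so the width of the
  numerical range is the sum of the two top values.\<close>

definition top_val :: "'a set \<Rightarrow> 'a op \<Rightarrow> real" where
  "top_val P h = Sup ((\<lambda>v. Re (vip P v (app P h v))) ` {v. vnorm P v = 1})"

lemma bdd_above_rayleigh:
  assumes "finite P"
  shows "bdd_above ((\<lambda>v. Re (vip P v (app P h v))) ` {v. vnorm P v = 1})"
proof (rule bdd_aboveI2)
  fix v assume "v \<in> {v. vnorm P v = 1}"
  then show "Re (vip P v (app P h v)) \<le> op_norm P h"
    using norm_vip_app_le[OF assms, of v h v] complex_Re_le_cmod[of "vip P v (app P h v)"] by simp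
qed

lemma Re_vip_le_top_val:
  assumes "finite P"
  shows "Re (vip P v (app P h v)) \<le> top_val P h * (vnorm P v)\<^sup>2"
proof (cases "vnorm P v = 0")
  case True
  then show ?thesis
    using norm_vip_app_le[OF assms, of v h v] by simp
next
  case False
  define c where "c = vnorm P v"
  have c: "c > 0" using False vnorm_nonneg[of P v] unfolding c_def by linarith
  define w where "w = (\<lambda>x. complex_of_real (1/c) * v x)"
  have w1: "vnorm P w = 1" using c unfolding w_def vnorm_scale by (simp add: norm_divide flip: c_def)
  have "Re (vip P w (app P h w)) \<le> top_val P h"
    unfolding top_val_def by (rule cSUP_upper[OF _ bdd_above_rayleigh[OF assms]]) (use w1 in simp)
  moreover have "vip P w (app P h w) = of_real (1/c\<^sup>2) * vip P v (app P h v)"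
    unfolding w_def app_scale vip_scale_left vip_scale_right using c by (simp add: power2_eq_square)
  ultimately show ?thesis using c by (simp add: c_def field_simps)
qed

lemma Re_vip_embed_le_top_val:
  assumes "S \<subseteq> {..<N}"
  shows "Re (vip (cfgs N d) \<phi> (app (cfgs N d) (embed N S h) \<phi>)) \<le> top_val (cf d S) h * (vnorm (cfgs N d) \<phi>)\<^sup>2"
proof -
  have "finite S" using assms finite_subset by blast
  then show ?thesis
    unfolding vip_embed_slices[OF assms] vnorm_slices[OF assms] Re_sum sum_distrib_left
    by (intro sum_mono Re_vip_le_top_val finite_cf)
qed

text \<open>The distributive law over disjoint blocks: it factors inner products of product vectors
  into one inner product for each block.\<close>

lemma sum_cf_prod_blocks:
  fixes f :: "'b \<Rightarrow> (nat \<Rightarrow> nat) \<Rightarrow> 'c::comm_semiring_1"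
  assumes "finite I" "\<And>i j. i \<in> I \<Longrightarrow> j \<in> I \<Longrightarrow> i \<noteq> j \<Longrightarrow> S i \<inter> S j = {}"
  shows "(\<Sum>x\<in>cf d (\<Union>i\<in>I. S i). \<Prod>i\<in>I. f i (restrict x (S i))) = (\<Prod>i\<in>I. \<Sum>z\<in>cf d (S i). f i z)"
  using assms
proof (induction I rule: finite_induct)
  case empty
  then show ?case by simp
next
  case (insert a I)
  let ?X = "\<Union>i\<in>I. S i"
  have dj: "S a \<inter> S i = {}" if "i \<in> I" for i using insert that by blast
  then have X: "(S a \<union> ?X) - S a = ?X" by blast
  have "(\<Sum>x\<in>cf d (\<Union>i\<in>insert a I. S i). \<Prod>i\<in>insert a I. f i (restrict x (S i)))
      = (\<Sum>w\<in>cf d ?X. \<Sum>z\<in>cf d (S a). \<Prod>i\<in>insert a I. f i (restrict (override_on w z (S a)) (S i)))"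
    using sum_cf_split[of "S a" "S a \<union> ?X" "\<lambda>x. \<Prod>i\<in>insert a I. f i (restrict x (S i))" d]
    by (simp add: X)
  also have "\<dots> = (\<Sum>w\<in>cf d ?X. \<Sum>z\<in>cf d (S a). f a z * (\<Prod>i\<in>I. f i (restrict w (S i))))"
  proof (intro sum.cong refl)
    fix w z assume "z \<in> cf d (S a)"
    moreover have "restrict (override_on w z (S a)) (S i) = restrict w (S i)" if "i \<in> I" for i
      using dj[OF that] by (auto simp: override_on_def restrict_def fun_eq_iff)
    ultimately show "(\<Prod>i\<in>insert a I. f i (restrict (override_on w z (S a)) (S i)))
        = f a z * (\<Prod>i\<in>I. f i (restrict w (S i)))"
      using insert by (simp add: restrict_override_on)
  qed
  also have "\<dots> = (\<Sum>z\<in>cf d (S a). f a z) * (\<Sum>w\<in>cf d ?X. \<Prod>i\<in>I. f i (restrict w (S i)))"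
    by (subst sum.swap) (simp add: sum_product)
  also have "\<dots> = (\<Prod>i\<in>insert a I. \<Sum>z\<in>cf d (S i). f i z)"
    using insert.hyps insert.IH insert.prems by (simp del: restrict_apply)
  finally show ?case .
qed

text \<open>Product vectors over the blocks show that the top values of the block operators add up.\<close>
lemma sum_top_val_le:
  fixes s :: nat
  assumes d: "0 < d"
    and S: "\<And>\<mu>. \<mu> < s \<Longrightarrow> S \<mu> \<subseteq> {..<N}"
    and disj: "\<And>\<mu> \<nu>. \<mu> < s \<Longrightarrow> \<nu> < s \<Longrightarrow> \<mu> \<noteq> \<nu> \<Longrightarrow> S \<mu> \<inter> S \<nu> = {}"
    and bound: "\<And>V. vnorm (cfgs N d) V = 1 \<Longrightarrow>
      (\<Sum>\<mu><s. Re (vip (cfgs N d) V (app (cfgs N d) (embed N (S \<mu>) (h \<mu>)) V))) \<le> b"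
  shows "(\<Sum>\<mu><s. top_val (cf d (S \<mu>)) (h \<mu>)) \<le> b"
proof (rule field_le_epsilon)
  fix e :: real assume e: "0 < e"
  \<comment> \<open>Each block gets a unit vector within \<open>\<delta>\<close> of its supremum,
    for a total loss of at most \<open>e\<close>. The summand 1 in the denominator covers
    \<open>s = 0\<close>.\<close>
  define \<delta> where "\<delta> = e / (real s + 1)"
  have \<delta>: "0 < \<delta>" "real s * \<delta> \<le> e" using e by (simp_all add: \<delta>_def field_simps)
  \<comment> \<open>The blocks need not cover all batteries. Index \<open>s\<close> collects the
    rest, so that \<open>Q\<close> on \<open>{..s}\<close> is a partition and a product vector lives
    on the whole system.\<close>
  define Q where "Q \<mu> = (if \<mu> < s then S \<mu> else {..<N} - (\<Union>\<nu><s. S \<nu>))" for \<mu>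
  have Qs: "Q \<mu> \<subseteq> {..<N}" for \<mu> using S by (auto simp: Q_def)
  have fQ: "finite (Q \<mu>)" for \<mu> using Qs finite_subset by blast
  have Qd: "Q \<mu> \<inter> Q \<nu> = {}" if "\<mu> \<in> {..s}" "\<nu> \<in> {..s}" "\<mu> \<noteq> \<nu>" for \<mu> \<nu>
    using that disj by (auto simp: Q_def)
  have QU: "(\<Union>\<mu>\<in>{..s}. Q \<mu>) = {..<N}"
  proof
    show "{..<N} \<subseteq> (\<Union>\<mu>\<in>{..s}. Q \<mu>)"
    proof
      fix i assume i: "i \<in> {..<N}"
      show "i \<in> (\<Union>\<mu>\<in>{..s}. Q \<mu>)"
      proof (cases "\<exists>\<nu><s. i \<in> S \<nu>")
        case True
        then obtain \<nu> where "\<nu> < s" "i \<in> S \<nu>" by blast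
        then show ?thesis by (intro UN_I[of \<nu>]) (auto simp: Q_def)
      next
        case False
        with i show ?thesis by (intro UN_I[of s]) (auto simp: Q_def)
      qed
    qed
  qed (use Qs in blast)
  have "\<exists>v. vnorm (cf d (Q \<mu>)) v = 1 \<and> top_val (cf d (Q \<mu>)) (h \<mu>) - \<delta> < Re (vip (cf d (Q \<mu>)) v (app (cf d (Q \<mu>)) (h \<mu>) v))" for \<mu>
  proof -
    have "{v. vnorm (cf d (Q \<mu>)) v = 1} \<noteq> {}"
      using ex_unit_vector[OF finite_cf[OF fQ] cf_nonempty[OF d]] by blast
    from less_cSUP_iff[OF this bdd_above_rayleigh[OF finite_cf[OF fQ]]]
    have "top_val (cf d (Q \<mu>)) (h \<mu>) - \<delta> < top_val (cf d (Q \<mu>)) (h \<mu>) \<longleftrightarrow> ?thesis"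
      unfolding top_val_def by auto
    then show ?thesis using \<delta> by simp
  qed
  then obtain v where v1: "\<And>\<mu>. vnorm (cf d (Q \<mu>)) (v \<mu>) = 1"
    and v2: "\<And>\<mu>. top_val (cf d (Q \<mu>)) (h \<mu>) - \<delta> < Re (vip (cf d (Q \<mu>)) (v \<mu>) (app (cf d (Q \<mu>)) (h \<mu>) (v \<mu>)))"
    by metis
  have v1': "(\<Sum>z\<in>cf d (Q \<mu>). cnj (v \<mu> z) * v \<mu> z) = 1" for \<mu>
    using vip_self[of "cf d (Q \<mu>)" "v \<mu>"] by (simp add: v1 vip_def)
  define V where "V x = (\<Prod>\<mu>\<le>s. v \<mu> (restrict x (Q \<mu>)))" for x
  have prods: "(\<Sum>x\<in>cfgs N d. \<Prod>\<mu>\<le>s. f \<mu> (restrict x (Q \<mu>))) = (\<Prod>\<mu>\<le>s. \<Sum>z\<in>cf d (Q \<mu>). f \<mu> z)"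
    for f :: "nat \<Rightarrow> (nat \<Rightarrow> nat) \<Rightarrow> complex"
    using sum_cf_prod_blocks[of "{..s}" Q f d] Qd by (simp add: QU cfgs_def)
  have "vip (cfgs N d) V V = 1"
    unfolding vip_def V_def cnj_prod prod.distrib[symmetric]
    by (subst prods[of "\<lambda>\<mu> z. cnj (v \<mu> z) * v \<mu> z"]) (simp add: v1')
  then have "vnorm (cfgs N d) V = 1"
    unfolding vip_self of_real_eq_1_iff using vnorm_nonneg[of "cfgs N d" V] by (simp add: power2_eq_1_iff)
  moreover have "vip (cfgs N d) V (app (cfgs N d) (embed N (S \<mu>) (h \<mu>)) V)
      = vip (cf d (Q \<mu>)) (v \<mu>) (app (cf d (Q \<mu>)) (h \<mu>) (v \<mu>))" if \<mu>: "\<mu> < s" for \<mu>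
  proof -
    have SQ: "S \<mu> = Q \<mu>" using \<mu> by (simp add: Q_def)
    \<comment> \<open>The embedded operator changes only the factor on block \<open>\<mu>\<close>;
      each other factor of the inner product is the squared length 1 of its vector.\<close>
    define f where "f \<nu> z = cnj (v \<nu> z) * (if \<nu> = \<mu> then app (cf d (Q \<mu>)) (h \<mu>) (v \<mu>) z else v \<nu> z)" for \<nu> z
    have split: "(\<Prod>\<nu>\<le>s. g \<nu>) = g \<mu> * (\<Prod>\<nu>\<in>{..s} - {\<mu>}. g \<nu>)" for g :: "nat \<Rightarrow> complex"
      by (rule prod.remove) (use \<mu> in auto)
    have *: "app (cfgs N d) (embed N (S \<mu>) (h \<mu>)) V x
       = app (cf d (Q \<mu>)) (h \<mu>) (v \<mu>) (restrict x (Q \<mu>)) * (\<Prod>\<nu>\<in>{..s} - {\<mu>}. v \<nu> (restrict x (Q \<nu>)))"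
      if x: "x \<in> cfgs N d" for x
    proof -
      have "V (override_on x z (Q \<mu>)) = v \<mu> z * (\<Prod>\<nu>\<in>{..s} - {\<mu>}. v \<nu> (restrict x (Q \<nu>)))"
        if z: "z \<in> cf d (Q \<mu>)" for z
      proof -
        have "restrict (override_on x z (Q \<mu>)) (Q \<nu>) = restrict x (Q \<nu>)" if "\<nu> \<in> {..s} - {\<mu>}" for \<nu>
          using Qd[of \<mu> \<nu>] that \<mu> by (auto simp: override_on_def restrict_def fun_eq_iff)
        then show ?thesis
          unfolding V_def split by (simp add: restrict_override_on[OF z])
      qed
      then show ?thesis
        unfolding SQ app_embed[OF Qs x] by (simp add: app_def sum_distrib_right mult.assoc)
    qed
    have "vip (cfgs N d) V (app (cfgs N d) (embed N (S \<mu>) (h \<mu>)) V)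
        = (\<Sum>x\<in>cfgs N d. \<Prod>\<nu>\<le>s. f \<nu> (restrict x (Q \<nu>)))"
      unfolding vip_def
    proof (intro sum.cong refl)
      fix x assume x: "x \<in> cfgs N d"
      show "cnj (V x) * app (cfgs N d) (embed N (S \<mu>) (h \<mu>)) V x = (\<Prod>\<nu>\<le>s. f \<nu> (restrict x (Q \<nu>)))"
        unfolding *[OF x] V_def split f_def cnj_prod
        by (simp add: prod.distrib mult_ac)
    qed
    also have "\<dots> = (\<Prod>\<nu>\<le>s. \<Sum>z\<in>cf d (Q \<nu>). f \<nu> z)" by (rule prods)
    also have "\<dots> = vip (cf d (Q \<mu>)) (v \<mu>) (app (cf d (Q \<mu>)) (h \<mu>) (v \<mu>))"
      unfolding split by (simp add: f_def v1' vip_def)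
    finally show ?thesis .
  qed
  ultimately have "(\<Sum>\<mu><s. Re (vip (cf d (Q \<mu>)) (v \<mu>) (app (cf d (Q \<mu>)) (h \<mu>) (v \<mu>)))) \<le> b"
    using bound[of V] by simp
  moreover have "(\<Sum>\<mu><s. top_val (cf d (S \<mu>)) (h \<mu>) - \<delta>)
      \<le> (\<Sum>\<mu><s. Re (vip (cf d (Q \<mu>)) (v \<mu>) (app (cf d (Q \<mu>)) (h \<mu>) (v \<mu>))))"
  proof (intro sum_mono)
    fix \<mu> assume "\<mu> \<in> {..<s}"
    then show "top_val (cf d (S \<mu>)) (h \<mu>) - \<delta> \<le> Re (vip (cf d (Q \<mu>)) (v \<mu>) (app (cf d (Q \<mu>)) (h \<mu>) (v \<mu>)))"
      using v2[of \<mu>] by (simp add: Q_def)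
  qed
  ultimately show "(\<Sum>\<mu><s. top_val (cf d (S \<mu>)) (h \<mu>)) \<le> b + e"
    using \<delta> by (simp add: sum_subtractf)
qed

text \<open>An observable outside the block commutes with the block Hamiltonian and a multiple \<open>\<beta> S\<close>
of the identity contributes nothing, so only \<open>k\<close> of the \<open>N\<close> summands of the observable count.\<close>
lemma Im_vip_rate_le:
  fixes s :: nat
  assumes d: "0 < d"
    and S: "\<And>\<mu>. \<mu> < s \<Longrightarrow> S \<mu> \<subseteq> {..<N} \<and> card (S \<mu>) \<le> k \<and> hermitian_on (cf d (S \<mu>)) (h \<mu>)"
    and disj: "\<And>\<mu> \<nu>. \<mu> < s \<Longrightarrow> \<nu> < s \<Longrightarrow> \<mu> \<noteq> \<nu> \<Longrightarrow> S \<mu> \<inter> S \<nu> = {}"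
    and H: "eq_on (cfgs N d) Hc (\<lambda>x y. \<Sum>\<mu><s. embed N (S \<mu>) (h \<mu>) x y)"
    and g: "\<And>j. j < N \<Longrightarrow> hermitian_on (cf d {j}) (g j)"
    and \<kappa>: "\<And>R. R \<subseteq> {..<N} \<Longrightarrow> card R \<le> k \<Longrightarrow>
       vnorm (cfgs N d) (\<lambda>x. (\<Sum>j\<in>R. app (cfgs N d) (embed N {j} (g j)) \<phi> x) + of_real (\<beta> R) * \<phi> x)
         * vnorm (cfgs N d) \<phi> \<le> \<kappa>"
  shows "Im (vip (cfgs N d) (app (cfgs N d) (\<lambda>x y. \<Sum>j<N. embed N {j} (g j) x y) \<phi>) (app (cfgs N d) Hc \<phi>))
      \<le> \<kappa> * op_norm (cfgs N d) Hc"
proof -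
  let ?B = "cfgs N d"
  let ?A = "\<lambda>j. app ?B (embed N {j} (g j)) \<phi>"
  let ?K = "\<lambda>\<mu>. embed N (S \<mu>) (h \<mu>)"
  let ?M = "\<lambda>\<mu>. top_val (cf d (S \<mu>)) (h \<mu>)"
  let ?M' = "\<lambda>\<mu>. top_val (cf d (S \<mu>)) (\<lambda>x y. - h \<mu> x y)"
  have Happ: "app ?B Hc \<psi> x = (\<Sum>\<mu><s. app ?B (?K \<mu>) \<psi> x)" if "x \<in> ?B" for x \<psi>
  proof -
    have "app ?B Hc \<psi> x = app ?B (\<lambda>x y. \<Sum>\<mu><s. ?K \<mu> x y) \<psi> x"
      by (rule app_cong) (use H that in \<open>auto simp: eq_on_def\<close>)
    then show ?thesis by (simp add: app_sum_op)
  qed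
  have hermK: "hermitian_on ?B (?K \<mu>)" if "\<mu> < s" for \<mu>
    using S[OF that] hermitian_embed by blast
  have hermA: "hermitian_on ?B (embed N {j} (g j))" if "j < N" for j
    using that by (intro hermitian_embed g) auto
  have neg: "app ?B (embed N R (\<lambda>x y. - f x y)) \<psi> = (\<lambda>x. - app ?B (embed N R f) \<psi> x)" for R f \<psi>
  proof -
    have "embed N R (\<lambda>x y. - f x y) x y = - embed N R f x y" for x y by (simp add: embed_def)
    then show ?thesis by (simp add: app_def sum_negf)
  qed
  have vneg: "vip ?B u (\<lambda>x. - w x) = - vip ?B u w" for u w by (simp add: vip_def sum_negf)
  have HV: "\<bar>\<Sum>\<mu><s. Re (vip ?B V (app ?B (?K \<mu>) V))\<bar> \<le> op_norm ?B Hc" if "vnorm ?B V = 1" for V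
  proof -
    have "vip ?B V (app ?B Hc V) = (\<Sum>\<mu><s. vip ?B V (app ?B (?K \<mu>) V))"
      unfolding vip_sum_right[symmetric] by (rule vip_cong) (auto simp: Happ)
    then have "(\<Sum>\<mu><s. Re (vip ?B V (app ?B (?K \<mu>) V))) = Re (vip ?B V (app ?B Hc V))" by simp
    also have "\<bar>\<dots>\<bar> \<le> cmod (vip ?B V (app ?B Hc V))" by (rule abs_Re_le_cmod)
    also have "\<dots> \<le> op_norm ?B Hc" using norm_vip_app_le[of ?B V Hc V] that by simp
    finally show ?thesis .
  qed
  have sM: "(\<Sum>\<mu><s. ?M \<mu>) \<le> op_norm ?B Hc"
  proof (rule sum_top_val_le[OF d])
    fix V assume "vnorm ?B V = 1"
    from HV[OF this] show "(\<Sum>\<mu><s. Re (vip ?B V (app ?B (?K \<mu>) V))) \<le> op_norm ?B Hc" by linarith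
  qed (simp_all add: S disj)
  have sM': "(\<Sum>\<mu><s. ?M' \<mu>) \<le> op_norm ?B Hc"
  proof (rule sum_top_val_le[OF d])
    fix V assume "vnorm ?B V = 1"
    from HV[OF this] show "(\<Sum>\<mu><s. Re (vip ?B V (app ?B (embed N (S \<mu>) (\<lambda>x y. - h \<mu> x y)) V))) \<le> op_norm ?B Hc"
      by (simp add: neg vneg sum_negf)
  qed (simp_all add: S disj)
  \<comment> \<open>The empty set is an admissible \<open>R\<close>, and it makes the bounded
    quantity a product of two lengths.\<close>
  have \<kappa>0: "0 \<le> \<kappa>"
  proof -
    have "0 \<le> vnorm ?B (\<lambda>x. (\<Sum>j\<in>{}. ?A j x) + of_real (\<beta> {}) * \<phi> x) * vnorm ?B \<phi>"
      by (intro mult_nonneg_nonneg vnorm_nonneg)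
    also have "\<dots> \<le> \<kappa>" by (rule \<kappa>) auto
    finally show ?thesis .
  qed
  have blk: "2 * Im (vip ?B (app ?B (\<lambda>x y. \<Sum>j<N. embed N {j} (g j) x y) \<phi>) (app ?B (?K \<mu>) \<phi>))
      \<le> (?M \<mu> + ?M' \<mu>) * \<kappa>" if \<mu>: "\<mu> < s" for \<mu>
  proof -
    have S\<mu>: "S \<mu> \<subseteq> {..<N}" "card (S \<mu>) \<le> k" using S[OF \<mu>] by auto
    define u where "u x = (\<Sum>j\<in>S \<mu>. ?A j x) + of_real (\<beta> (S \<mu>)) * \<phi> x" for x
    \<comment> \<open>For a battery outside the block the two hermitian operators commute, so this
      inner product equals its own conjugate.\<close>
    have z: "Im (vip ?B (?A j) (app ?B (?K \<mu>) \<phi>)) = 0" if j: "j \<in> {..<N} - S \<mu>" for j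
    proof -
      have "vip ?B (?A j) (app ?B (?K \<mu>) \<phi>) = vip ?B \<phi> (app ?B (embed N {j} (g j)) (app ?B (?K \<mu>) \<phi>))"
        using hermA[of j] j by (simp add: vip_hermitian)
      also have "\<dots> = vip ?B \<phi> (app ?B (?K \<mu>) (?A j))"
        using j S\<mu> by (intro vip_cong refl embed_commute) auto
      also have "\<dots> = vip ?B (app ?B (?K \<mu>) \<phi>) (?A j)"
        by (rule vip_hermitian[OF hermK[OF \<mu>]])
      also have "\<dots> = cnj (vip ?B (?A j) (app ?B (?K \<mu>) \<phi>))" by (simp add: vip_cnj)
      finally show ?thesis by (metis cnj.simps(2) equal_neg_zero)
    qed
    have "Im (vip ?B (app ?B (\<lambda>x y. \<Sum>j<N. embed N {j} (g j) x y) \<phi>) (app ?B (?K \<mu>) \<phi>))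
        = (\<Sum>j<N. Im (vip ?B (?A j) (app ?B (?K \<mu>) \<phi>)))"
      by (simp add: app_sum_op vip_sum_left[symmetric] flip: Im_sum)
    also have "\<dots> = (\<Sum>j\<in>S \<mu>. Im (vip ?B (?A j) (app ?B (?K \<mu>) \<phi>)))"
      by (rule sum.mono_neutral_right) (use S\<mu> z in auto)
    \<comment> \<open>The real multiple of \<open>\<phi>\<close> inside \<open>u\<close> contributes
      a real multiple of the expectation of a hermitian operator, which has no imaginary
      part.\<close>
    also have "\<dots> = Im (vip ?B u (app ?B (?K \<mu>) \<phi>))"
      unfolding u_def vip_add_left vip_sum_left vip_scale_left
      using Im_vip_hermitian[OF hermK[OF \<mu>], of \<phi>] by simp
    finally have eq: "Im (vip ?B (app ?B (\<lambda>x y. \<Sum>j<N. embed N {j} (g j) x y) \<phi>) (app ?B (?K \<mu>) \<phi>))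
        = Im (vip ?B u (app ?B (?K \<mu>) \<phi>))" .
    have hi: "Re (vip ?B \<psi> (app ?B (?K \<mu>) \<psi>)) \<le> ?M \<mu> * (vnorm ?B \<psi>)\<^sup>2"
      and lo: "- Re (vip ?B \<psi> (app ?B (?K \<mu>) \<psi>)) \<le> ?M' \<mu> * (vnorm ?B \<psi>)\<^sup>2" for \<psi>
      using Re_vip_embed_le_top_val[OF S\<mu>(1), of d \<psi> "h \<mu>"]
        Re_vip_embed_le_top_val[OF S\<mu>(1), of d \<psi> "\<lambda>x y. - h \<mu> x y"] by (simp_all add: neg vneg)
    have "Im (vip ?B \<phi> u) = 0"
    proof -
      have "Im (vip ?B \<phi> (?A j)) = 0" if "j \<in> S \<mu>" for j
        using that S\<mu> by (intro Im_vip_hermitian hermA) auto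
      then show ?thesis unfolding u_def vip_add_right vip_sum_right vip_scale_right
        by (simp add: vip_self)
    qed
    then have "2 * Im (vip ?B u (app ?B (?K \<mu>) \<phi>)) \<le> (?M \<mu> + ?M' \<mu>) * (vnorm ?B u * vnorm ?B \<phi>)"
      by (rule Im_vip_le_width[OF hermK[OF \<mu>]]) (fact hi lo)+
    also have "\<dots> \<le> (?M \<mu> + ?M' \<mu>) * \<kappa>"
    proof (rule mult_left_mono)
      show "vnorm ?B u * vnorm ?B \<phi> \<le> \<kappa>" unfolding u_def by (rule \<kappa>) (use S\<mu> in auto)
      obtain v where "vnorm ?B v = 1"
        using ex_unit_vector[of ?B] cf_nonempty[OF d, of "{..<N}"] by (auto simp: cfgs_def)
      with hi[of v] lo[of v] show "0 \<le> ?M \<mu> + ?M' \<mu>" by simp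
    qed
    finally show ?thesis unfolding eq .
  qed
  have "2 * Im (vip ?B (app ?B (\<lambda>x y. \<Sum>j<N. embed N {j} (g j) x y) \<phi>) (app ?B Hc \<phi>))
     = (\<Sum>\<mu><s. 2 * Im (vip ?B (app ?B (\<lambda>x y. \<Sum>j<N. embed N {j} (g j) x y) \<phi>) (app ?B (?K \<mu>) \<phi>)))"
  proof -
    have "vip ?B u (app ?B Hc \<phi>) = (\<Sum>\<mu><s. vip ?B u (app ?B (?K \<mu>) \<phi>))" for u
      unfolding vip_sum_right[symmetric] by (rule vip_cong) (auto simp: Happ)
    then show ?thesis by (simp add: sum_distrib_left)
  qed
  also have "\<dots> \<le> (\<Sum>\<mu><s. (?M \<mu> + ?M' \<mu>) * \<kappa>)"
    by (intro sum_mono blk) auto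
  also have "\<dots> = ((\<Sum>\<mu><s. ?M \<mu>) + (\<Sum>\<mu><s. ?M' \<mu>)) * \<kappa>"
    by (simp add: sum_distrib_right sum.distrib distrib_right)
  \<comment> \<open>The upper and the lower ends of the numerical ranges each add up to at most the
    collective norm; the resulting factor 2 cancels the one on the left.\<close>
  also have "\<dots> \<le> (op_norm ?B Hc + op_norm ?B Hc) * \<kappa>"
    by (intro mult_right_mono add_mono sM sM' \<kappa>0)
  finally show ?thesis by (simp add: mult.commute)
qed

section \<open>Evolution of an expectation value\<close>

text \<open>Halving the increment of \<open>F\<close> halves the total quadratic error. This stands in for the product rule,
which fails pointwise because the Hamiltonian is merely integrable in time.\<close>
lemma increment_le_of_quadratic_error:
  fixes F g :: "real \<Rightarrow> real"
  assumes "a \<le> b" "continuous_on {a..b} F"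
    and step: "\<And>s t. a \<le> s \<Longrightarrow> s \<le> t \<Longrightarrow> t \<le> b \<Longrightarrow> g t - g s \<le> c * (F t - F s) + C * (F t - F s)\<^sup>2"
    and mono: "\<And>s t. a \<le> s \<Longrightarrow> s \<le> t \<Longrightarrow> t \<le> b \<Longrightarrow> F s \<le> F t"
  shows "g b - g a \<le> c * (F b - F a)"
proof -
  have *: "g b - g a \<le> c * (F b - F a) + C * (F b - F a)\<^sup>2 / 2 ^ n" for n
    using assms
  proof (induction n arbitrary: a b)
    case 0
    from 0(3)[of a b] 0(1) show ?case by simp
  next
    case (Suc n)
    \<comment> \<open>The bisection is in the value of \<open>F\<close>, not in time: two halves of
      size D/2 have squares adding up to half the square of D.\<close>
    have "F a \<le> (F a + F b) / 2" "(F a + F b) / 2 \<le> F b"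
      using Suc.prems(4)[of a b] Suc.prems(1) by auto
    from IVT'[OF this Suc.prems(1,2)] obtain m where m: "a \<le> m" "m \<le> b" "F m = (F a + F b) / 2"
      by auto
    have "g m - g a \<le> c * (F m - F a) + C * (F m - F a)\<^sup>2 / 2 ^ n"
      by (rule Suc.IH) (use m Suc.prems in \<open>auto intro: continuous_on_subset\<close>)
    moreover have "g b - g m \<le> c * (F b - F m) + C * (F b - F m)\<^sup>2 / 2 ^ n"
      by (rule Suc.IH) (use m Suc.prems in \<open>auto intro: continuous_on_subset\<close>)
    moreover have "F m - F a = (F b - F a) / 2" "F b - F m = (F b - F a) / 2"
      using m(3) by (simp_all add: field_simps)
    ultimately have "g b - g a \<le> c * ((F b - F a) / 2) + C * ((F b - F a) / 2)\<^sup>2 / 2 ^ n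
        + (c * ((F b - F a) / 2) + C * ((F b - F a) / 2)\<^sup>2 / 2 ^ n)" by simp
    also have "\<dots> = c * (F b - F a) + C * (F b - F a)\<^sup>2 / 2 ^ Suc n"
      by (simp add: power_divide)
    finally show ?case .
  qed
  have "(\<lambda>n. c * (F b - F a) + C * (F b - F a)\<^sup>2 * (1 / 2) ^ n) \<longlonglongrightarrow> c * (F b - F a) + C * (F b - F a)\<^sup>2 * 0"
    by (intro tendsto_intros LIMSEQ_power_zero) auto
  then show ?thesis
    by (intro LIMSEQ_le_const[where X="\<lambda>n. c * (F b - F a) + C * (F b - F a)\<^sup>2 * (1 / 2) ^ n"])
       (use * in \<open>auto simp: power_one_over field_simps\<close>)
qed

text \<open>The evolution of one vector instead of the propagator. The vector need not be
  normalised, since the vectors into which a mixed state is decomposed are not.\<close>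

locale evolution =
  fixes B :: "'a set" and H :: "real \<Rightarrow> 'a op" and T :: real and \<phi> :: "real \<Rightarrow> 'a \<Rightarrow> complex"
  assumes fin: "finite B" and ne: "B \<noteq> {}"
    and herm: "\<And>t. t \<in> {0..T} \<Longrightarrow> hermitian_on B (H t)"
    and entries: "\<And>x y. x \<in> B \<Longrightarrow> y \<in> B \<Longrightarrow> (\<lambda>t. H t x y) integrable_on {0..T}"
    and norms: "(\<lambda>t. op_norm B (H t)) integrable_on {0..T}"
    and evol_int: "\<And>t x. t \<in> {0..T} \<Longrightarrow> x \<in> B \<Longrightarrow> (\<lambda>s. app B (H s) (\<phi> s) x) integrable_on {0..t}"
    and evol: "\<And>t x. t \<in> {0..T} \<Longrightarrow> x \<in> B \<Longrightarrow>
      \<phi> t x = \<phi> 0 x - \<i> * integral {0..t} (\<lambda>s. app B (H s) (\<phi> s) x)"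
begin

text \<open>The accumulated norm is the clock of the evolution: vector increments are of first order
  in \<open>F t - F s\<close>, however irregular the Hamiltonian is in time.\<close>

definition F :: "real \<Rightarrow> real" where
  "F t = integral {0..t} (\<lambda>s. op_norm B (H s))"

lemma integral_norm_eq:
  assumes "0 \<le> s" "s \<le> t" "t \<le> T"
  shows "((\<lambda>s. op_norm B (H s)) has_integral (F t - F s)) {s..t}"
proof -
  have "(\<lambda>s. op_norm B (H s)) integrable_on {0..t}" "(\<lambda>s. op_norm B (H s)) integrable_on {s..t}"
    using norms assms by (auto intro: integrable_on_subinterval)
  then show ?thesis
    unfolding F_def has_integral_integrable_integral
    using Henstock_Kurzweil_Integration.integral_combine[of 0 s t "\<lambda>s. op_norm B (H s)"] assms by auto
qed

lemma F_mono: "0 \<le> s \<Longrightarrow> s \<le> t \<Longrightarrow> t \<le> T \<Longrightarrow> F s \<le> F t"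
  using has_integral_nonneg[OF integral_norm_eq[of s t]] op_norm_nonneg[OF fin ne] by auto

lemma F_0 [simp]: "F 0 = 0"
  by (simp add: F_def)

lemma F_cont: "continuous_on {0..T} F"
  unfolding F_def by (rule indefinite_integral_continuous_1[OF norms])

lemma increment:
  assumes "0 \<le> s" "s \<le> t" "t \<le> T" "x \<in> B"
  shows "((\<lambda>\<tau>. app B (H \<tau>) (\<phi> \<tau>) x) has_integral \<i> * (\<phi> t x - \<phi> s x)) {s..t}"
proof -
  let ?f = "\<lambda>\<tau>. app B (H \<tau>) (\<phi> \<tau>) x"
  have i: "?f integrable_on {0..t}" using evol_int[of t x] assms by auto
  then have "?f integrable_on {s..t}" using assms by (auto intro: integrable_on_subinterval)
  moreover have "integral {s..t} ?f = \<i> * (\<phi> t x - \<phi> s x)"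
  proof -
    have t: "\<phi> t x = \<phi> 0 x - \<i> * integral {0..t} ?f" and s: "\<phi> s x = \<phi> 0 x - \<i> * integral {0..s} ?f"
      using evol[of t x] evol[of s x] assms by auto
    have "integral {0..t} ?f = integral {0..s} ?f + integral {s..t} ?f"
      using Henstock_Kurzweil_Integration.integral_combine[of 0 s t ?f] i assms by auto
    then have "\<phi> t x - \<phi> s x = - \<i> * integral {s..t} ?f" unfolding t s by (simp add: algebra_simps)
    then show ?thesis by simp
  qed
  ultimately show ?thesis by (simp add: has_integral_integrable_integral)
qed

text \<open>An a priori bound from continuity on a compact interval. Conservation of the length is
  available only later, because its proof goes through \<open>expectation_growth\<close>, which
  needs some bound already.\<close>

lemma vnorm_bounded: "\<exists>M\<ge>0. \<forall>t\<in>{0..T}. vnorm B (\<phi> t) \<le> M"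
proof -
  have "\<exists>m. \<forall>t\<in>{0..T}. cmod (\<phi> t x) \<le> m" if x: "x \<in> B" for x
  proof (cases "0 \<le> T")
    case True
    then have "(\<lambda>s. app B (H s) (\<phi> s) x) integrable_on {0..T}" using evol_int[of T x] x by auto
    then have "continuous_on {0..T} (\<lambda>t. \<phi> 0 x - \<i> * integral {0..t} (\<lambda>s. app B (H s) (\<phi> s) x))"
      by (intro continuous_intros indefinite_integral_continuous_1)
    then have "continuous_on {0..T} (\<lambda>t. \<phi> t x)"
      by (rule continuous_on_eq) (rule evol[OF _ x, symmetric])
    then have "bounded ((\<lambda>t. \<phi> t x) ` {0..T})"
      by (intro compact_imp_bounded compact_continuous_image) auto
    then show ?thesis unfolding bounded_iff by auto
  qed auto
  then obtain m where m: "\<And>x t. x \<in> B \<Longrightarrow> t \<in> {0..T} \<Longrightarrow> cmod (\<phi> t x) \<le> m x" by metis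
  have "vnorm B (\<phi> t) \<le> \<bar>\<Sum>x\<in>B. m x\<bar>" if "t \<in> {0..T}" for t
  proof -
    have "vnorm B (\<phi> t) \<le> (\<Sum>x\<in>B. cmod (\<phi> t x))" by (rule vnorm_le_sum)
    also have "\<dots> \<le> (\<Sum>x\<in>B. m x)" by (intro sum_mono m that)
    finally show ?thesis by simp
  qed
  then show ?thesis by (meson abs_ge_zero)
qed

text \<open>The factor \<open>card B\<close> comes from estimating each component separately. It is
  harmless, since this bound enters only second-order errors and the choice of a short initial
  interval.\<close>

lemma vnorm_increment_le:
  assumes M: "\<And>t. t \<in> {0..T} \<Longrightarrow> vnorm B (\<phi> t) \<le> M" and st: "0 \<le> s" "s \<le> t" "t \<le> T"
  shows "vnorm B (\<lambda>x. \<phi> t x - \<phi> s x) \<le> card B * (M * (F t - F s))"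
proof -
  have "cmod (\<phi> t x - \<phi> s x) \<le> M * (F t - F s)" if x: "x \<in> B" for x
  proof -
    have "cmod (app B (H \<tau>) (\<phi> \<tau>) x) \<le> M * op_norm B (H \<tau>)" if "\<tau> \<in> {s..t}" for \<tau>
    proof -
      have "cmod (app B (H \<tau>) (\<phi> \<tau>) x) \<le> vnorm B (app B (H \<tau>) (\<phi> \<tau>))"
        by (rule norm_le_vnorm[OF fin x])
      also have "\<dots> \<le> op_norm B (H \<tau>) * vnorm B (\<phi> \<tau>)" by (rule vnorm_app_le[OF fin])
      also have "\<dots> \<le> op_norm B (H \<tau>) * M"
        by (intro mult_left_mono M op_norm_nonneg fin ne) (use that st in auto)
      finally show ?thesis by (simp add: mult.commute)
    qed
    moreover have "((\<lambda>\<tau>. M * op_norm B (H \<tau>)) has_integral (M * (F t - F s))) {s..t}"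
      by (intro has_integral_mult_right integral_norm_eq st)
    ultimately have "norm (integral {s..t} (\<lambda>\<tau>. app B (H \<tau>) (\<phi> \<tau>) x)) \<le> integral {s..t} (\<lambda>\<tau>. M * op_norm B (H \<tau>))"
      using increment[OF st x] by (intro integral_norm_bound_integral) (auto simp: has_integral_integrable_integral)
    also have "integral {s..t} (\<lambda>\<tau>. M * op_norm B (H \<tau>)) = M * (F t - F s)"
      by (intro integral_unique has_integral_mult_right integral_norm_eq st)
    finally show ?thesis
      unfolding integral_unique[OF increment[OF st x]] by (simp add: norm_mult)
  qed
  then have "(\<Sum>x\<in>B. cmod (\<phi> t x - \<phi> s x)) \<le> (\<Sum>x\<in>B. M * (F t - F s))" by (intro sum_mono)
  with vnorm_le_sum[of B "\<lambda>x. \<phi> t x - \<phi> s x"] show ?thesis by simp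
qed

lemma vip_increment:
  assumes "0 \<le> s" "s \<le> t" "t \<le> T"
  shows "((\<lambda>\<tau>. vip B u (app B (H \<tau>) (\<phi> \<tau>))) has_integral \<i> * vip B u (\<lambda>x. \<phi> t x - \<phi> s x)) {s..t}"
proof -
  have "((\<lambda>\<tau>. \<Sum>x\<in>B. cnj (u x) * app B (H \<tau>) (\<phi> \<tau>) x) has_integral
      (\<Sum>x\<in>B. cnj (u x) * (\<i> * (\<phi> t x - \<phi> s x)))) {s..t}"
    by (intro has_integral_sum has_integral_mult_right increment fin assms)
  then show ?thesis by (simp add: vip_def sum_distrib_left mult.left_commute)
qed

text \<open>Formally the expectation has the derivative 2 Im <A phi, H phi>. On a short interval the
  vector is frozen at the left end \<open>s\<close>, where \<open>rate\<close> controls the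
  first-order term; all the rest is quadratic in the increment of \<open>F\<close>. This is why
  \<open>rate\<close> takes the vector and the Hamiltonian at independent times.\<close>

lemma expectation_growth:
  assumes A: "hermitian_on B A" and ab: "0 \<le> a" "a \<le> b" "b \<le> T"
    and rate: "\<And>s \<tau>. s \<in> {a..b} \<Longrightarrow> \<tau> \<in> {0..<T} \<Longrightarrow>
      Im (vip B (app B A (\<phi> s)) (app B (H \<tau>) (\<phi> s))) \<le> \<kappa> * op_norm B (H \<tau>)"
  shows "Re (vip B (\<phi> b) (app B A (\<phi> b))) - Re (vip B (\<phi> a) (app B A (\<phi> a))) \<le> 2 * \<kappa> * (F b - F a)"
proof -
  obtain M where M0: "M \<ge> 0" and M: "\<And>t. t \<in> {0..T} \<Longrightarrow> vnorm B (\<phi> t) \<le> M"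
    using vnorm_bounded by blast
  define n where "n = real (card B) * M"
  define \<alpha> where "\<alpha> = op_norm B A"
  have n0: "n \<ge> 0" by (simp add: n_def M0)
  have \<alpha>0: "\<alpha> \<ge> 0" unfolding \<alpha>_def by (rule op_norm_nonneg[OF fin ne])
  \<comment> \<open>The first summand is twice the error from freezing the vector in the cross term,
    the second bounds the term that is quadratic in the increment \<open>D\<close>.\<close>
  define C where "C = 2 * (\<alpha> * M * n) + \<alpha> * n\<^sup>2"
  show ?thesis
  proof (rule increment_le_of_quadratic_error[where C=C])
    show "a \<le> b" by fact
    show "continuous_on {a..b} F" using F_cont by (rule continuous_on_subset) (use ab in auto)
    show "F s \<le> F t" if "a \<le> s" "s \<le> t" "t \<le> b" for s t
      using that ab by (intro F_mono) auto
    fix s t assume st': "a \<le> s" "s \<le> t" "t \<le> b"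
    then have st: "0 \<le> s" "s \<le> t" "t \<le> T" using ab by auto
    define L where "L = F t - F s"
    have L0: "L \<ge> 0" using F_mono[OF st] by (simp add: L_def)
    define u where "u = app B A (\<phi> s)"
    define D where "D = (\<lambda>x. \<phi> t x - \<phi> s x)"
    have un: "vnorm B u \<le> \<alpha> * M"
    proof -
      have "vnorm B u \<le> \<alpha> * vnorm B (\<phi> s)" unfolding u_def \<alpha>_def by (rule vnorm_app_le[OF fin])
      also have "\<dots> \<le> \<alpha> * M" by (intro mult_left_mono M \<alpha>0) (use st in auto)
      finally show ?thesis .
    qed
    have inc: "vnorm B (\<lambda>x. \<phi> \<tau> x - \<phi> s x) \<le> n * L" if "\<tau> \<in> {s..t}" for \<tau>
    proof -
      have "vnorm B (\<lambda>x. \<phi> \<tau> x - \<phi> s x) \<le> card B * (M * (F \<tau> - F s))"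
        by (rule vnorm_increment_le) (use M that st in auto)
      also have "\<dots> \<le> card B * (M * (F t - F s))"
        by (intro mult_left_mono M0 diff_right_mono F_mono) (use that st in auto)
      finally show ?thesis by (simp add: n_def L_def mult.assoc)
    qed
    \<comment> \<open>\<open>?f\<close> has the vector frozen at time \<open>s\<close>;
      \<open>?r\<close> is the remainder, and its integral is of second order in
      \<open>L\<close>.\<close>
    let ?f = "\<lambda>\<tau>. vip B u (app B (H \<tau>) (\<phi> s))"
    let ?r = "\<lambda>\<tau>. vip B u (app B (H \<tau>) (\<lambda>x. \<phi> \<tau> x - \<phi> s x))"
    have fi: "?f integrable_on {s..t}"
      unfolding vip_def app_def using st
      by (intro integrable_sum integrable_on_mult_right integrable_on_mult_left fin
            integrable_on_subinterval[OF entries]) auto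
    have tot: "((\<lambda>\<tau>. ?f \<tau> + ?r \<tau>) has_integral \<i> * vip B u D) {s..t}"
      using vip_increment[OF st, of u] by (simp add: D_def app_diff vip_diff_right)
    have ri: "?r integrable_on {s..t}"
      using integrable_diff[OF has_integral_integrable[OF tot] fi] by simp
    have sum: "integral {s..t} ?f + integral {s..t} ?r = \<i> * vip B u D"
      using integral_add[OF fi ri] integral_unique[OF tot] by simp
    have nint: "((\<lambda>\<tau>. q * op_norm B (H \<tau>)) has_integral (q * L)) {s..t}" for q
      unfolding L_def by (intro has_integral_mult_right integral_norm_eq st)
    have r: "cmod (integral {s..t} ?r) \<le> (\<alpha> * M * (n * L)) * L"
    proof -
      have "cmod (?r \<tau>) \<le> (\<alpha> * M * (n * L)) * op_norm B (H \<tau>)" if "\<tau> \<in> {s..t}" for \<tau>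
      proof -
        have "cmod (?r \<tau>) \<le> op_norm B (H \<tau>) * vnorm B u * vnorm B (\<lambda>x. \<phi> \<tau> x - \<phi> s x)"
          by (rule norm_vip_app_le[OF fin])
        also have "\<dots> \<le> op_norm B (H \<tau>) * (\<alpha> * M) * (n * L)"
          by (intro mult_mono un inc that order_refl mult_nonneg_nonneg op_norm_nonneg fin ne \<alpha>0 M0 vnorm_nonneg)
        finally show ?thesis by (simp add: mult_ac)
      qed
      then have "norm (integral {s..t} ?r) \<le> integral {s..t} (\<lambda>\<tau>. (\<alpha> * M * (n * L)) * op_norm B (H \<tau>))"
        by (intro integral_norm_bound_integral ri has_integral_integrable[OF nint])
      also have "\<dots> = (\<alpha> * M * (n * L)) * L" by (rule integral_unique[OF nint])
      finally show ?thesis .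
    qed
    have "((\<lambda>\<tau>. Im (?f \<tau>)) has_integral Im (integral {s..t} ?f)) {s..t}"
      using has_integral_linear[OF integrable_integral[OF fi] bounded_linear_Im] by (simp add: o_def)
    \<comment> \<open>\<open>rate\<close> says nothing at \<open>\<tau> = T\<close>, since the steps
      of a circuit are half-open on the right; altering one point leaves the integral
      unchanged.\<close>
    then have "((\<lambda>\<tau>. if \<tau> = T then \<kappa> * op_norm B (H \<tau>) else Im (?f \<tau>)) has_integral Im (integral {s..t} ?f)) {s..t}"
      by (rule has_integral_spike_finite[of "{T}", rotated 2]) auto
    then have f: "Im (integral {s..t} ?f) \<le> \<kappa> * L"
      by (rule has_integral_le[OF _ nint]) (use rate[of s] st st' ab in \<open>auto simp: u_def\<close>)
    have "Re (vip B u D) = Im (\<i> * vip B u D)" by simp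
    also have "\<dots> = Im (integral {s..t} ?f) + Im (integral {s..t} ?r)" by (simp flip: sum)
    also have "\<dots> \<le> \<kappa> * L + (\<alpha> * M * (n * L)) * L"
      using f r abs_Im_le_cmod[of "integral {s..t} ?r"] by linarith
    finally have first: "Re (vip B u D) \<le> \<kappa> * L + \<alpha> * M * n * L\<^sup>2" by (simp add: power2_eq_square mult_ac)
    have second: "Re (vip B D (app B A D)) \<le> \<alpha> * n\<^sup>2 * L\<^sup>2"
    proof -
      have "Re (vip B D (app B A D)) \<le> cmod (vip B D (app B A D))" by (rule complex_Re_le_cmod)
      also have "\<dots> \<le> \<alpha> * vnorm B D * vnorm B D" unfolding \<alpha>_def by (rule norm_vip_app_le[OF fin])
      also have "\<dots> \<le> \<alpha> * (n * L) * (n * L)"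
        using inc[of t] st n0 L0 unfolding D_def
        by (intro mult_mono order_refl mult_nonneg_nonneg vnorm_nonneg \<alpha>0) auto
      finally show ?thesis by (simp add: power2_eq_square mult_ac)
    qed
    have "\<phi> t = (\<lambda>x. \<phi> s x + D x)" by (simp add: D_def)
    then have "Re (vip B (\<phi> t) (app B A (\<phi> t))) = Re (vip B (\<lambda>x. \<phi> s x + D x) (app B A (\<lambda>x. \<phi> s x + D x)))"
      by simp
    also have "\<dots> = Re (vip B (\<phi> s) u) + Re (vip B (\<phi> s) (app B A D)) + Re (vip B D u) + Re (vip B D (app B A D))"
      by (simp add: app_add vip_add_left vip_add_right u_def)
    also have "vip B (\<phi> s) (app B A D) = vip B u D" unfolding u_def by (rule vip_hermitian[OF A])
    also have "Re (vip B D u) = Re (vip B u D)" by (subst vip_cnj[of B u D, symmetric]) simp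
    finally have "Re (vip B (\<phi> t) (app B A (\<phi> t))) - Re (vip B (\<phi> s) (app B A (\<phi> s)))
        = 2 * Re (vip B u D) + Re (vip B D (app B A D))" by (simp add: u_def)
    also have "\<dots> \<le> 2 * \<kappa> * L + C * L\<^sup>2"
      using first second by (simp add: C_def algebra_simps)
    finally show "Re (vip B (\<phi> t) (app B A (\<phi> t))) - Re (vip B (\<phi> s) (app B A (\<phi> s)))
       \<le> 2 * \<kappa> * (F t - F s) + C * (F t - F s)\<^sup>2" by (simp add: L_def)
  qed
qed

text \<open>Multiples of the identity have charging rate zero under a hermitian Hamiltonian; the
  multiples 1 and -1 give the two inequalities.\<close>

lemma vnorm_conserved:
  assumes t: "t \<in> {0..T}"
  shows "vnorm B (\<phi> t) = vnorm B (\<phi> 0)"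
proof -
  have id: "app B (\<lambda>x y. of_real e * op_id x y) v x = of_real e * v x" if "x \<in> B" for e :: real and v x
    using app_id[OF fin that, of v] by (simp add: app_def mult.assoc flip: sum_distrib_left)
  have vid: "vip B v (app B (\<lambda>x y. of_real e * op_id x y) v) = of_real (e * (vnorm B v)\<^sup>2)" for e :: real and v
  proof -
    have "vip B v (app B (\<lambda>x y. of_real e * op_id x y) v) = vip B v (\<lambda>x. of_real e * v x)"
      by (rule vip_cong) (auto simp: id)
    then show ?thesis by (simp add: vip_scale_right vip_self)
  qed
  have "e * (vnorm B (\<phi> t))\<^sup>2 - e * (vnorm B (\<phi> 0))\<^sup>2 \<le> 0" for e :: real
  proof -
    have "Re (vip B (\<phi> t) (app B (\<lambda>x y. of_real e * op_id x y) (\<phi> t)))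
        - Re (vip B (\<phi> 0) (app B (\<lambda>x y. of_real e * op_id x y) (\<phi> 0))) \<le> 2 * 0 * (F t - F 0)"
    proof (rule expectation_growth)
      show "hermitian_on B (\<lambda>x y. of_real e * op_id x y)" by (simp add: hermitian_on_def op_id_def)
      fix s \<tau> assume \<tau>: "\<tau> \<in> {0..<T}"
      have "vip B (app B (\<lambda>x y. of_real e * op_id x y) (\<phi> s)) (app B (H \<tau>) (\<phi> s))
          = vip B (\<lambda>x. of_real e * \<phi> s x) (app B (H \<tau>) (\<phi> s))"
        by (rule vip_cong) (auto simp: id)
      then show "Im (vip B (app B (\<lambda>x y. of_real e * op_id x y) (\<phi> s)) (app B (H \<tau>) (\<phi> s))) \<le> 0 * op_norm B (H \<tau>)"
        using Im_vip_hermitian[OF herm, of \<tau> "\<phi> s"] \<tau> by (simp add: vip_scale_left)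
    qed (use t in auto)
    then show ?thesis unfolding vid by simp
  qed
  from this[of 1] this[of "-1"] have "(vnorm B (\<phi> t))\<^sup>2 = (vnorm B (\<phi> 0))\<^sup>2" by simp
  then show ?thesis by (simp add: power2_eq_iff_nonneg)
qed

end

section \<open>Product states and additive observables\<close>

text \<open>Cholesky elimination, one basis element at a time: the column at \<open>a\<close>,
  scaled by the root of the pivot, is split off, and the Schur complement \<open>R'\<close> is again
  positive semidefinite. The lemma turns a mixed state into vectors that evolve
  independently.\<close>

lemma psd_decomposition:
  assumes "finite B" "hermitian_on B R" "\<And>v. 0 \<le> Re (vip B v (app B R v))"
  shows "\<exists>w. \<forall>x\<in>B. \<forall>y\<in>B. R x y = (\<Sum>b\<in>B. w b x * cnj (w b y))"
  using assms
proof (induction B arbitrary: R rule: finite_induct)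
  case empty
  then show ?case by simp
next
  case (insert a B)
  define r where "r = Re (R a a)"
  have her: "R x y = cnj (R y x)" if "x \<in> insert a B" "y \<in> insert a B" for x y
    using insert.prems(1) that unfolding hermitian_on_def by blast
  have Raa: "R a a = of_real r"
    using her[of a a] by (simp add: r_def complex_eq_iff)
  have expand: "Re (vip (insert a B) (v(a := z)) (app (insert a B) R (v(a := z))))
      = (cmod z)\<^sup>2 * r + 2 * Re (cnj z * app B R v a) + Re (vip B v (app B R v))" for v z
  proof -
    have ap: "app (insert a B) R (v(a := z)) x = R x a * z + app B R v x" for x
    proof -
      have "(\<Sum>y\<in>B. R x y * (v(a := z)) y) = (\<Sum>y\<in>B. R x y * v y)"
        by (rule sum.cong) (use insert.hyps in auto)
      then show ?thesis using insert.hyps by (simp add: app_def)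
    qed
    have "vip B (v(a := z)) (\<lambda>x. R x a * z + app B R v x) = vip B v (\<lambda>x. z * R x a + app B R v x)"
      by (rule vip_cong) (use insert.hyps in \<open>auto simp: mult.commute\<close>)
    also have "\<dots> = z * vip B v (\<lambda>x. R x a) + vip B v (app B R v)"
      by (simp add: vip_add_right vip_scale_right)
    also have "vip B v (\<lambda>x. R x a) = cnj (app B R v a)"
      unfolding vip_def app_def cnj_sum
      by (rule sum.cong) (auto simp: her[of _ a])
    finally have *: "vip B (v(a := z)) (\<lambda>x. R x a * z + app B R v x)
        = z * cnj (app B R v a) + vip B v (app B R v)" .
    have "vip (insert a B) (v(a := z)) (\<lambda>x. R x a * z + app B R v x)
      = cnj z * (R a a * z + app B R v a) + vip B (v(a := z)) (\<lambda>x. R x a * z + app B R v x)"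
      using insert.hyps by (simp add: vip_def)
    then show ?thesis
      unfolding ap * Raa cmod_power2 by (simp add: algebra_simps power2_eq_square)
  qed
  have r0: "0 \<le> r"
    using insert.prems(2)[of "(\<lambda>x. 0)(a := 1)"] unfolding expand by (simp add: app_def vip_def)
  have zero: "app B R v a = 0" if "r = 0" for v
  proof (rule ccontr)
    assume n: "app B R v a \<noteq> 0"
    define S where "S = app B R v a"
    \<comment> \<open>With this \<open>t\<close> the quadratic form at
      \<open>v(a := - t * S)\<close> would equal -1.\<close>
    define t where "t = (Re (vip B v (app B R v)) + 1) / (2 * (cmod S)\<^sup>2)"
    have "Re (cnj (- of_real t * S) * S) = - t * (cmod S)\<^sup>2"
      unfolding cmod_power2 by (simp add: algebra_simps power2_eq_square)
    then have "0 \<le> - (2 * t * (cmod S)\<^sup>2) + Re (vip B v (app B R v))"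
      using insert.prems(2)[of "v(a := - of_real t * S)"] that unfolding expand by (simp flip: S_def)
    moreover have "2 * t * (cmod S)\<^sup>2 = Re (vip B v (app B R v)) + 1"
      using n by (simp add: t_def S_def)
    ultimately show False by simp
  qed
  have pos: "(cmod (app B R v a))\<^sup>2 / r \<le> Re (vip B v (app B R v))" if "0 < r" for v
  proof -
    \<comment> \<open>The value \<open>- S / r\<close> in coordinate \<open>a\<close> minimises the
      quadratic form, and the minimum is the form of the Schur complement at
      \<open>v\<close>.\<close>
    define S where "S = app B R v a"
    have "Re (cnj (- S / of_real r) * S) = - (cmod S)\<^sup>2 / r"
      unfolding cmod_power2 by (simp add: add_divide_distrib diff_divide_distrib power2_eq_square)
    moreover have "(cmod (- S / of_real r))\<^sup>2 * r = (cmod S)\<^sup>2 / r"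
      using that by (simp add: norm_divide power_divide power2_eq_square)
    ultimately have "0 \<le> (cmod S)\<^sup>2 / r + 2 * (- (cmod S)\<^sup>2 / r) + Re (vip B v (app B R v))"
      using insert.prems(2)[of "v(a := - S / of_real r)"] unfolding expand by (simp only: flip: S_def)
    then show ?thesis by (simp add: S_def)
  qed
  \<comment> \<open>For a zero pivot the whole column vanishes by \<open>zero\<close>, so nothing
    has to be split off.\<close>
  define c where "c x = (if r = 0 then 0 else R x a / of_real (sqrt r))" for x
  define R' where "R' x y = R x y - c x * cnj (c y)" for x y
  have Rxa: "R x a = c x * cnj (c a)" if x: "x \<in> insert a B" for x
  proof (cases "r = 0")
    case True
    show ?thesis
    proof (cases "x = a")
      case True
      with \<open>r = 0\<close> Raa show ?thesis by (simp add: c_def)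
    next
      case False
      with x have xB: "x \<in> B" by simp
      have "app B R (\<lambda>y. if y = x then 1 else 0) a = R a x"
        using xB insert.hyps by (simp add: app_def if_distrib[of "\<lambda>u. _ * u"] cong: if_cong)
      with zero[OF \<open>r = 0\<close>] have "R a x = 0" by metis
      then show ?thesis using her[of x a] x \<open>r = 0\<close> by (simp add: c_def)
    qed
  next
    case False
    then have "cnj (c a) = of_real (sqrt r)"
      using r0 by (simp add: c_def Raa real_div_sqrt flip: of_real_divide)
    then show ?thesis using False by (simp add: c_def)
  qed
  have "hermitian_on B R'"
    unfolding hermitian_on_def
  proof (intro ballI)
    fix x y assume "x \<in> B" "y \<in> B"
    then have "R x y = cnj (R y x)" by (intro her) auto
    then show "R' x y = cnj (R' y x)" by (simp add: R'_def mult.commute)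
  qed
  moreover have "0 \<le> Re (vip B v (app B R' v))" for v
  proof -
    have "app B R' v x = app B R v x - vip B c v * c x" for x
      unfolding app_def R'_def vip_def sum_distrib_right sum_subtractf[symmetric]
      by (intro sum.cong) (auto simp: algebra_simps)
    then have "vip B v (app B R' v) = vip B v (\<lambda>x. app B R v x - vip B c v * c x)"
      by (intro vip_cong) auto
    also have "\<dots> = vip B v (app B R v) - vip B c v * vip B v c"
      by (simp only: vip_diff_right vip_scale_right)
    also have "vip B v c = cnj (vip B c v)" by (simp add: vip_cnj)
    finally have *: "Re (vip B v (app B R' v)) = Re (vip B v (app B R v)) - (cmod (vip B c v))\<^sup>2"
      unfolding cmod_power2 by (simp add: power2_eq_square)
    show ?thesis
    proof (cases "r = 0")
      case True
      then have "vip B c v = 0" by (simp add: vip_def c_def)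
      moreover have "0 \<le> Re (vip B v (app B R v))"
        using insert.prems(2)[of "v(a := 0)"] unfolding expand by simp
      ultimately show ?thesis using * by simp
    next
      case False
      have "vip B c v = app B R v a / of_real (sqrt r)"
        unfolding vip_def app_def sum_divide_distrib
        by (rule sum.cong) (use False her[of a] in \<open>auto simp: c_def\<close>)
      then have "(cmod (vip B c v))\<^sup>2 = (cmod (app B R v a))\<^sup>2 / r"
        using r0 by (simp add: norm_divide power_divide)
      then show ?thesis using * pos[of v] False r0 by simp
    qed
  qed
  ultimately obtain w where w: "\<And>x y. x \<in> B \<Longrightarrow> y \<in> B \<Longrightarrow> R' x y = (\<Sum>b\<in>B. w b x * cnj (w b y))"
    using insert.IH[of R'] by blast
  define w' where "w' b x = (if b = a then c x else if x = a then 0 else w b x)" for b x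
  show ?case
  proof (intro exI ballI)
    fix x y assume xy: "x \<in> insert a B" "y \<in> insert a B"
    have "(\<Sum>b\<in>insert a B. w' b x * cnj (w' b y)) = c x * cnj (c y) + (\<Sum>b\<in>B. w' b x * cnj (w' b y))"
      using insert.hyps by (simp add: w'_def)
    also have "(\<Sum>b\<in>B. w' b x * cnj (w' b y)) = R x y - c x * cnj (c y)"
    proof (cases "x = a \<or> y = a")
      case True
      have "(\<Sum>b\<in>B. w' b x * cnj (w' b y)) = 0"
        by (rule sum.neutral) (use insert.hyps True in \<open>auto simp: w'_def\<close>)
      moreover have "R x y = c x * cnj (c y)"
        using True Rxa xy her[of a y] by auto
      ultimately show ?thesis by simp
    next
      case False
      then have "(\<Sum>b\<in>B. w' b x * cnj (w' b y)) = (\<Sum>b\<in>B. w b x * cnj (w b y))"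
        by (intro sum.cong) (use insert.hyps in \<open>auto simp: w'_def\<close>)
      with w[of x y] False xy show ?thesis by (simp add: R'_def)
    qed
    finally show "R x y = (\<Sum>b\<in>insert a B. w' b x * cnj (w' b y))" by simp
  qed
qed

text \<open>Expanding the product of sums selects one vector for each battery, so the product
  vectors are indexed by configurations once more.\<close>

lemma tensor_pow_decomposition:
  assumes "\<And>x y. x < d \<Longrightarrow> y < d \<Longrightarrow> \<rho> x y = (\<Sum>b<d. w b x * cnj (w b y))"
    and "x \<in> cfgs N d" "y \<in> cfgs N d"
  shows "tensor_pow N \<rho> x y = (\<Sum>f\<in>cfgs N d. (\<Prod>i<N. w (f i) (x i)) * cnj (\<Prod>i<N. w (f i) (y i)))"
proof -
  have "tensor_pow N \<rho> x y = (\<Prod>i<N. \<Sum>b<d. w b (x i) * cnj (w b (y i)))"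
    unfolding tensor_pow_def by (rule prod.cong) (use assms in \<open>auto simp: cfgs_def PiE_iff\<close>)
  also have "\<dots> = (\<Sum>f\<in>cfgs N d. \<Prod>i<N. w (f i) (x i) * cnj (w (f i) (y i)))"
    unfolding cfgs_def by (rule prod_sum_PiE) auto
  finally show ?thesis by (simp add: prod.distrib cnj_prod)
qed

text \<open>A single-battery operator as an operator on the block \<open>{j}\<close>, whose
  configurations are functions on \<open>{j}\<close>; thus the block lemmas apply to observables as
  well.\<close>

definition on_site :: "nat \<Rightarrow> nat op \<Rightarrow> (nat \<Rightarrow> nat) op" where
  "on_site j a = (\<lambda>x y. a (x j) (y j))"

definition total_obs :: "nat \<Rightarrow> nat op \<Rightarrow> (nat \<Rightarrow> nat) op" where
  "total_obs N a = (\<lambda>x y. \<Sum>j<N. embed N {j} (on_site j a) x y)"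

lemma sum_cf_singleton: "(\<Sum>z\<in>cf d {j}. G z) = (\<Sum>u<d. G (restrict (\<lambda>_. u) {j}))"
proof (rule sum.reindex_bij_witness[where i="\<lambda>u. restrict (\<lambda>_. u) {j}" and j="\<lambda>z. z j"])
  fix z assume "z \<in> cf d {j}"
  then show "restrict (\<lambda>_. z j) {j} = z" "z j \<in> {..<d}"
    by (auto simp: PiE_iff extensional_def fun_eq_iff)
  then show "G (restrict (\<lambda>_. z j) {j}) = G z" by (simp only:)
qed auto

lemma hermitian_on_site:
  assumes "hermitian_on (batt d) a"
  shows "hermitian_on (cf d {j}) (on_site j a)"
  unfolding hermitian_on_def on_site_def
proof (intro ballI)
  fix x y assume "x \<in> cf d {j}" "y \<in> cf d {j}"
  then have "x j \<in> batt d" "y j \<in> batt d" by (auto simp: batt_def)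
  with assms show "a (x j) (y j) = cnj (a (y j) (x j))" unfolding hermitian_on_def by blast
qed

lemma hermitian_total_obs:
  assumes "hermitian_on (batt d) a"
  shows "hermitian_on (cfgs N d) (total_obs N a)"
proof -
  have "hermitian_on (cfgs N d) (embed N {j} (on_site j a))" if "j < N" for j
    using that by (intro hermitian_embed hermitian_on_site assms) auto
  then show ?thesis
    unfolding hermitian_on_def total_obs_def cnj_sum by (intro ballI sum.cong refl) blast
qed

lemma vnorm_on_site_le:
  assumes "0 < d" "j < N"
  shows "vnorm (cfgs N d) (app (cfgs N d) (embed N {j} (on_site j a)) \<phi>)
     \<le> op_norm (batt d) a * vnorm (cfgs N d) \<phi>"
proof (rule vnorm_embed_le)
  have fin: "finite (batt d)" "batt d \<noteq> {}" using assms by (auto simp: batt_def lessThan_empty_iff)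
  show "0 \<le> op_norm (batt d) a" by (rule op_norm_nonneg[OF fin])
  show "{j} \<subseteq> {..<N}" using assms by simp
  fix v :: "(nat \<Rightarrow> nat) \<Rightarrow> complex"
  let ?v = "\<lambda>u. v (restrict (\<lambda>_. u) {j})"
  have n: "vnorm (cf d {j}) f = vnorm (batt d) (\<lambda>u. f (restrict (\<lambda>_. u) {j}))" for f
    unfolding vnorm_def L2_set_def sum_cf_singleton by (simp add: batt_def)
  have "app (cf d {j}) (on_site j a) v (restrict (\<lambda>_. u) {j}) = app (batt d) a ?v u" for u
    unfolding app_def sum_cf_singleton by (simp add: batt_def on_site_def)
  then show "vnorm (cf d {j}) (app (cf d {j}) (on_site j a) v) \<le> op_norm (batt d) a * vnorm (cf d {j}) v"
    unfolding n using vnorm_app_le[OF fin(1), of a ?v] by simp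
qed

lemma sum_vip_eq_trace:
  assumes "\<And>x y. x \<in> B \<Longrightarrow> y \<in> B \<Longrightarrow> R x y = (\<Sum>f\<in>I. v f x * cnj (v f y))"
  shows "(\<Sum>f\<in>I. vip B (v f) (app B A (v f))) = (\<Sum>x\<in>B. \<Sum>y\<in>B. A x y * R y x)"
proof -
  have "(\<Sum>f\<in>I. vip B (v f) (app B A (v f))) = (\<Sum>f\<in>I. \<Sum>x\<in>B. \<Sum>y\<in>B. A x y * (v f y * cnj (v f x)))"
    by (simp add: vip_def app_def sum_distrib_left mult_ac)
  also have "\<dots> = (\<Sum>x\<in>B. \<Sum>y\<in>B. \<Sum>f\<in>I. A x y * (v f y * cnj (v f x)))"
    by (subst sum.swap, rule sum.cong[OF refl], rule sum.swap)
  also have "\<dots> = (\<Sum>x\<in>B. \<Sum>y\<in>B. A x y * R y x)"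
    by (intro sum.cong refl) (simp add: assms sum_distrib_left)
  finally show ?thesis .
qed

lemma trace_tensor_pow:
  assumes "(\<Sum>u<d. \<tau> u u) = 1"
  shows "(\<Sum>x\<in>cfgs N d. tensor_pow N \<tau> x x) = 1"
proof -
  have "(\<Sum>x\<in>cfgs N d. tensor_pow N \<tau> x x) = (\<Prod>i<N. \<Sum>u<d. \<tau> u u)"
    unfolding tensor_pow_def cfgs_def by (rule prod_sum_PiE[symmetric]) auto
  then show ?thesis by (simp add: assms)
qed

text \<open>In the summand for battery \<open>j\<close> the trace factors over the batteries, and
  every other battery contributes the trace 1 of \<open>\<tau>\<close>.\<close>

lemma trace_total_obs:
  assumes "(\<Sum>u<d. \<tau> u u) = 1"
  shows "(\<Sum>x\<in>cfgs N d. \<Sum>y\<in>cfgs N d. total_obs N a x y * tensor_pow N \<tau> y x)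
    = of_nat N * (\<Sum>u<d. \<Sum>z<d. a u z * \<tau> z u)"
proof -
  have one: "(\<Sum>x\<in>cfgs N d. \<Sum>y\<in>cfgs N d. embed N {j} (on_site j a) x y * tensor_pow N \<tau> y x)
    = (\<Sum>u<d. \<Sum>z<d. a u z * \<tau> z u)" if j: "j < N" for j
  proof -
    define g where "g i u = (if i = j then \<Sum>z<d. a u z * \<tau> z u else \<tau> u u)" for i u
    have split: "(\<Prod>i<N. f i) = f j * (\<Prod>i\<in>{..<N} - {j}. f i)" for f :: "nat \<Rightarrow> complex"
      by (rule prod.remove) (use j in auto)
    have "(\<Sum>y\<in>cfgs N d. embed N {j} (on_site j a) x y * tensor_pow N \<tau> y x) = (\<Prod>i<N. g i (x i))"
      if x: "x \<in> cfgs N d" for x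
    proof -
      have "(\<Sum>y\<in>cfgs N d. embed N {j} (on_site j a) x y * tensor_pow N \<tau> y x)
          = app (cfgs N d) (embed N {j} (on_site j a)) (\<lambda>y. tensor_pow N \<tau> y x) x"
        by (simp add: app_def)
      also have "\<dots> = (\<Sum>z<d. a (x j) z * tensor_pow N \<tau> (override_on x (restrict (\<lambda>_. z) {j}) {j}) x)"
        using j x by (simp add: app_embed sum_cf_singleton on_site_def)
      also have "\<dots> = (\<Sum>z<d. a (x j) z * \<tau> z (x j)) * (\<Prod>i\<in>{..<N} - {j}. \<tau> (x i) (x i))"
        unfolding tensor_pow_def split sum_distrib_right
        by (intro sum.cong refl) (simp add: override_on_def)
      also have "\<dots> = (\<Prod>i<N. g i (x i))"
        unfolding split by (simp add: g_def)
      finally show ?thesis .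
    qed
    then have "(\<Sum>x\<in>cfgs N d. \<Sum>y\<in>cfgs N d. embed N {j} (on_site j a) x y * tensor_pow N \<tau> y x)
        = (\<Sum>x\<in>cfgs N d. \<Prod>i<N. g i (x i))" by simp
    also have "\<dots> = (\<Prod>i<N. \<Sum>u<d. g i u)"
      unfolding cfgs_def by (rule prod_sum_PiE[symmetric]) auto
    also have "\<dots> = (\<Sum>u<d. \<Sum>z<d. a u z * \<tau> z u)"
      unfolding split by (simp add: g_def assms)
    finally show ?thesis .
  qed
  have "(\<Sum>x\<in>cfgs N d. \<Sum>y\<in>cfgs N d. total_obs N a x y * tensor_pow N \<tau> y x)
    = (\<Sum>j<N. \<Sum>x\<in>cfgs N d. \<Sum>y\<in>cfgs N d. embed N {j} (on_site j a) x y * tensor_pow N \<tau> y x)"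
    unfolding total_obs_def sum_distrib_right by (rule trans[OF sum.cong[OF refl sum.swap] sum.swap])
  then show ?thesis by (simp add: one)
qed

text \<open>By linearity the propagator carries each vector of a decomposition of the initial state
  along its own solution, and the final vectors decompose the final state.\<close>

lemma drives_imp_evolution:
  assumes "drives B H T \<rho> \<sigma>" and fin: "finite B" and ne: "B \<noteq> {}"
    and \<rho>: "\<And>x y. x \<in> B \<Longrightarrow> y \<in> B \<Longrightarrow> \<rho> x y = (\<Sum>f\<in>I. w f x * cnj (w f y))"
  obtains \<phi> where "\<And>f. f \<in> I \<Longrightarrow> evolution B H T (\<phi> f)"
    "\<And>f x. x \<in> B \<Longrightarrow> \<phi> f 0 x = w f x"
    "\<And>x y. x \<in> B \<Longrightarrow> y \<in> B \<Longrightarrow> \<sigma> x y = (\<Sum>f\<in>I. \<phi> f T x * cnj (\<phi> f T y))"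
proof -
  from assms(1) obtain U where T: "0 \<le> T" and herm: "\<And>t. t \<in> {0..T} \<Longrightarrow> hermitian_on B (H t)"
    and absi: "\<And>x y. x \<in> B \<Longrightarrow> y \<in> B \<Longrightarrow> (\<lambda>t. H t x y) absolutely_integrable_on {0..T}"
    and norms: "(\<lambda>t. op_norm B (H t)) integrable_on {0..T}"
    and Ui: "\<And>t x y. t \<in> {0..T} \<Longrightarrow> x \<in> B \<Longrightarrow> y \<in> B \<Longrightarrow>
        (\<lambda>s. op_mult B (H s) (U s) x y) integrable_on {0..t}"
    and Ue: "\<And>t x y. t \<in> {0..T} \<Longrightarrow> x \<in> B \<Longrightarrow> y \<in> B \<Longrightarrow>
        U t x y = op_id x y - \<i> * integral {0..t} (\<lambda>s. op_mult B (H s) (U s) x y)"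
    and \<sigma>: "eq_on B \<sigma> (op_mult B (op_mult B (U T) \<rho>) (op_adj (U T)))"
    unfolding drives_def solves_schroedinger_def by blast
  define \<phi> where "\<phi> f t = app B (U t) (w f)" for f t
  have init: "\<phi> f 0 x = w f x" if x: "x \<in> B" for f x
  proof -
    have "app B (U 0) (w f) x = app B op_id (w f) x"
      by (rule app_cong) (use Ue[of 0 x] x T in auto)
    then show ?thesis by (simp add: \<phi>_def app_id[OF fin x])
  qed
  have HU: "app B (H s) (\<phi> f s) x = (\<Sum>y\<in>B. op_mult B (H s) (U s) x y * w f y)" for f s x
  proof -
    have "app B (H s) (\<phi> f s) x = (\<Sum>z\<in>B. \<Sum>y\<in>B. H s x z * U s z y * w f y)"
      by (simp add: \<phi>_def app_def sum_distrib_left mult.assoc)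
    also have "\<dots> = (\<Sum>y\<in>B. \<Sum>z\<in>B. H s x z * U s z y * w f y)" by (rule sum.swap)
    finally show ?thesis by (simp add: op_mult_def sum_distrib_right)
  qed
  have hi: "((\<lambda>s. app B (H s) (\<phi> f s) x) has_integral
      (\<Sum>y\<in>B. integral {0..t} (\<lambda>s. op_mult B (H s) (U s) x y) * w f y)) {0..t}"
    if "t \<in> {0..T}" "x \<in> B" for f t x
    unfolding HU by (intro has_integral_sum has_integral_mult_left integrable_integral Ui that fin)
  have "evolution B H T (\<phi> f)" for f
  proof
    fix t x assume t: "t \<in> {0..T}" and x: "x \<in> B"
    show "(\<lambda>s. app B (H s) (\<phi> f s) x) integrable_on {0..t}" using hi[OF t x] by blast
    have "\<phi> f t x = (\<Sum>y\<in>B. (op_id x y - \<i> * integral {0..t} (\<lambda>s. op_mult B (H s) (U s) x y)) * w f y)"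
      unfolding \<phi>_def app_def by (intro sum.cong refl) (use Ue[OF t x] in simp)
    also have "\<dots> = app B op_id (w f) x - \<i> * (\<Sum>y\<in>B. integral {0..t} (\<lambda>s. op_mult B (H s) (U s) x y) * w f y)"
      by (simp add: app_def left_diff_distrib sum_subtractf sum_distrib_left mult.assoc)
    finally show "\<phi> f t x = \<phi> f 0 x - \<i> * integral {0..t} (\<lambda>s. app B (H s) (\<phi> f s) x)"
      using integral_unique[OF hi[OF t x, of f]] init[OF x, of f] app_id[OF fin x, of "w f"] by simp
  qed (use herm norms absi fin ne in \<open>auto dest: set_lebesgue_integral_eq_integral(1)\<close>)
  moreover have "\<sigma> x y = (\<Sum>f\<in>I. \<phi> f T x * cnj (\<phi> f T y))" if x: "x \<in> B" and y: "y \<in> B" for x y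
  proof -
    have "\<sigma> x y = (\<Sum>z\<in>B. (\<Sum>w\<in>B. U T x w * \<rho> w z) * cnj (U T y z))"
      using \<sigma> x y by (simp add: eq_on_def op_mult_def op_adj_def)
    also have "\<dots> = (\<Sum>z\<in>B. \<Sum>u\<in>B. \<Sum>f\<in>I. (U T x u * w f u) * cnj (U T y z * w f z))"
      by (intro sum.cong refl) (simp add: \<rho> sum_distrib_left sum_distrib_right mult_ac)
    also have "\<dots> = (\<Sum>f\<in>I. \<Sum>z\<in>B. \<Sum>u\<in>B. (U T x u * w f u) * cnj (U T y z * w f z))"
      by (rule trans[OF sum.cong[OF refl sum.swap] sum.swap])
    also have "\<dots> = (\<Sum>f\<in>I. \<phi> f T x * cnj (\<phi> f T y))"
      by (intro sum.cong refl) (simp only: \<phi>_def app_def cnj_sum sum_product, rule sum.swap)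
    finally show ?thesis .
  qed
  ultimately show thesis using that init by blast
qed

section \<open>Optimal charging of a single battery\<close>

text \<open>\<open>K\<close> swaps the lowest and the highest level with strength \<open>E\<close>.
  Its evolution rotates their plane with angular velocity \<open>E\<close>, so a quarter turn maps
  the ground state to \<open>- \<i>\<close> times the top level; the phase drops out of the density
  operator.\<close>

lemma rotation_drives:
  fixes E :: real
  assumes d: "2 \<le> d" and E: "0 < E"
    and \<rho>: "eq_on (batt d) \<rho> (proj 0)" and \<sigma>: "eq_on (batt d) \<sigma> (proj (d - 1))"
  defines "K \<equiv> \<lambda>x y. if x = 0 \<and> y = d - 1 \<or> x = d - 1 \<and> y = 0 then complex_of_real E else 0"
  shows "drives (batt d) (\<lambda>_. K) (pi / (2 * E)) \<rho> \<sigma>" and "op_norm (batt d) K \<le> E"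
proof -
  define m where "m = d - 1"
  have m: "m \<noteq> 0" "0 < m" "m < d" "0 < d" using d by (auto simp: m_def)
  have fin: "finite (batt d)" "batt d \<noteq> {}" using m by (auto simp: batt_def lessThan_empty_iff)
  have K: "K x y = (if x = 0 then if y = m then of_real E else 0 else if x = m then if y = 0 then of_real E else 0 else 0)" for x y
    using m by (auto simp: K_def m_def)
  have sumK: "(\<Sum>z\<in>batt d. K x z * f z) = (if x = 0 then E * f m else if x = m then E * f 0 else 0)" for x and f :: "nat \<Rightarrow> complex"
    unfolding K using m by (auto simp: batt_def if_distrib[of "\<lambda>u. u * _"] cong: if_cong)
  show "op_norm (batt d) K \<le> E"
  proof (rule op_norm_le[OF fin])
    fix v :: "nat \<Rightarrow> complex"
    have "(vnorm (batt d) (app (batt d) K v))\<^sup>2 = (\<Sum>x\<in>{0,m}. (cmod (if x = 0 then E * v m else if x = m then E * v 0 else 0))\<^sup>2)"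
      unfolding vnorm_sq app_def sumK by (rule sum.mono_neutral_right) (use m in \<open>auto simp: batt_def\<close>)
    also have "\<dots> = E\<^sup>2 * (\<Sum>x\<in>{0,m}. (cmod (v x))\<^sup>2)"
      using m by (simp add: norm_mult power_mult_distrib algebra_simps)
    also have "\<dots> \<le> E\<^sup>2 * (vnorm (batt d) v)\<^sup>2"
      unfolding vnorm_sq by (intro mult_left_mono sum_mono2) (use m in \<open>auto simp: batt_def\<close>)
    finally have "(vnorm (batt d) (app (batt d) K v))\<^sup>2 \<le> (E * vnorm (batt d) v)\<^sup>2"
      by (simp add: power_mult_distrib)
    then show "vnorm (batt d) (app (batt d) K v) \<le> E * vnorm (batt d) v"
      by (rule power2_le_imp_le) (use E in simp)
  qed
  \<comment> \<open>\<open>U t\<close> is the exponential of -itK: \<open>p\<close> projects onto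
    the plane, \<open>q\<close> is \<open>- \<i>\<close> times \<open>K / E\<close>, and
    \<open>r\<close> is the identity on the levels that \<open>K\<close> annihilates.\<close>
  define p where "p x y = (if x = y \<and> (x = 0 \<or> x = m) then 1 else 0 :: complex)" for x y
  define q where "q x y = (if x = 0 \<and> y = m \<or> x = m \<and> y = 0 then - \<i> else 0 :: complex)" for x y
  define r where "r x y = (if x = y \<and> x \<noteq> 0 \<and> x \<noteq> m then 1 else 0 :: complex)" for x y
  define U where "U t x y = p x y * of_real (cos (E * t)) + q x y * of_real (sin (E * t)) + r x y" for t x y
  have KU: "op_mult (batt d) K (U t) x y
      = \<i> * (p x y * of_real (- sin (E * t) * E) + q x y * of_real (cos (E * t) * E))" for t x y
    unfolding op_mult_def sumK using m by (auto simp: U_def p_def q_def r_def)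
  have ftc: "((\<lambda>s. op_mult (batt d) K (U s) x y) has_integral (\<i> * U t x y - \<i> * U 0 x y)) {0..t}"
    if "0 \<le> t" for t x y
  proof (rule fundamental_theorem_of_calculus[OF that])
    fix s
    have "((\<lambda>s. \<i> * (p x y * of_real (cos (E * s)) + q x y * of_real (sin (E * s)) + r x y)) has_vector_derivative
        \<i> * (p x y * of_real (- sin (E * s) * E) + q x y * of_real (cos (E * s) * E) + 0)) (at s within {0..t})"
      by (intro has_vector_derivative_mult_right has_vector_derivative_add has_vector_derivative_const
            has_vector_derivative_of_real) (auto intro!: derivative_eq_intros)
    then show "((\<lambda>s. \<i> * U s x y) has_vector_derivative op_mult (batt d) K (U s) x y) (at s within {0..t})"
      unfolding KU U_def by simp
  qed
  have U0: "U 0 x y = op_id x y" for x y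
    by (auto simp: U_def p_def q_def r_def op_id_def)
  have "solves_schroedinger (batt d) (\<lambda>_. K) (pi / (2 * E)) U"
    unfolding solves_schroedinger_def
  proof (intro ballI conjI)
    fix t x y assume "t \<in> {0..pi / (2 * E)}"
    then have f: "((\<lambda>s. op_mult (batt d) K (U s) x y) has_integral (\<i> * U t x y - \<i> * op_id x y)) {0..t}"
      using ftc[of t x y] by (simp add: U0)
    then show "(\<lambda>s. op_mult (batt d) K (U s) x y) integrable_on {0..t}" by blast
    show "U t x y = op_id x y - \<i> * integral {0..t} (\<lambda>s. op_mult (batt d) K (U s) x y)"
      unfolding integral_unique[OF f] by (simp add: algebra_simps)
  qed
  moreover have "eq_on (batt d) \<sigma> (op_mult (batt d) (op_mult (batt d) (U (pi / (2 * E))) \<rho>) (op_adj (U (pi / (2 * E)))))"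
    unfolding eq_on_def
  proof (intro ballI)
    fix x y assume xy: "x \<in> batt d" "y \<in> batt d"
    let ?U = "U (pi / (2 * E))"
    have Ux: "?U x 0 = (if x = m then - \<i> else 0)" for x
      using E m by (auto simp: U_def p_def q_def r_def)
    have in1: "(\<Sum>w\<in>batt d. ?U x w * \<rho> w z) = (if z = 0 then ?U x 0 else 0)" if "z \<in> batt d" for z
    proof -
      have "(\<Sum>w\<in>batt d. ?U x w * \<rho> w z) = (\<Sum>w\<in>batt d. if w = 0 then if z = 0 then ?U x 0 else 0 else 0)"
        using \<rho> that by (intro sum.cong) (auto simp: eq_on_def proj_def)
      then show ?thesis using m by (simp add: batt_def)
    qed
    have "op_mult (batt d) (op_mult (batt d) ?U \<rho>) (op_adj ?U) x y
        = (\<Sum>z\<in>batt d. if z = 0 then ?U x 0 * cnj (?U y 0) else 0)"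
      unfolding op_mult_def op_adj_def by (intro sum.cong) (auto simp: in1)
    also have "\<dots> = ?U x 0 * cnj (?U y 0)" using m by (simp add: batt_def)
    also have "\<dots> = proj m x y" by (simp add: Ux proj_def)
    also have "\<dots> = \<sigma> x y" using \<sigma> xy by (simp add: eq_on_def m_def)
    finally show "\<sigma> x y = op_mult (batt d) (op_mult (batt d) ?U \<rho>) (op_adj ?U) x y" by simp
  qed
  moreover have "hermitian_on (batt d) K" by (auto simp: hermitian_on_def K_def)
  ultimately show "drives (batt d) (\<lambda>_. K) (pi / (2 * E)) \<rho> \<sigma>"
    unfolding drives_def using E by (auto intro!: absolutely_integrable_on_const)
qed

lemma optimal_time_le:
  assumes "optimal_single d \<rho> \<sigma> E H T" "2 \<le> d" "0 < E"
    and "eq_on (batt d) \<rho> (proj 0)" "eq_on (batt d) \<sigma> (proj (d - 1))"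
  shows "T \<le> pi / (2 * E)"
  using assms(1) rotation_drives[OF assms(2-5)] unfolding optimal_single_def by blast

section \<open>Charging by circuits\<close>

lemma partition_segment:
  fixes tt :: "nat \<Rightarrow> real"
  assumes "tt 0 \<le> \<tau>" "\<tau> < tt m"
  shows "\<exists>j<m. tt j \<le> \<tau> \<and> \<tau> < tt (Suc j)"
  using assms(2)
proof (induction m)
  case 0
  then show ?case using assms(1) by simp
next
  case (Suc m)
  show ?case
  proof (cases "\<tau> < tt m")
    case True
    with Suc.IH show ?thesis by (meson less_SucI)
  next
    case False
    with Suc.prems show ?thesis by (intro exI[of _ m]) auto
  qed
qed

text \<open>The blocks belong to the step containing \<open>\<tau>\<close>, the vector to an
  unrelated time \<open>s\<close>; hence \<open>\<kappa>\<close> must serve every set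
  \<open>R\<close> of at most \<open>k\<close> batteries. The subinterval and the shift
  \<open>\<beta>\<close> allow a smaller \<open>\<kappa>\<close> near the start.\<close>

lemma circuit_expectation_growth:
  assumes cp: "circuit_protocol d N k Hc T \<rho> \<sigma>" and d: "0 < d" and a: "hermitian_on (batt d) a"
    and ev: "evolution (cfgs N d) Hc T \<phi>" and s: "0 \<le> s0" "s0 \<le> s1" "s1 \<le> T"
    and \<kappa>: "\<And>s R. s \<in> {s0..s1} \<Longrightarrow> R \<subseteq> {..<N} \<Longrightarrow> card R \<le> k \<Longrightarrow>
       vnorm (cfgs N d) (\<lambda>x. (\<Sum>j\<in>R. app (cfgs N d) (embed N {j} (on_site j a)) (\<phi> s) x) + of_real (\<beta> R) * \<phi> s x)
         * vnorm (cfgs N d) (\<phi> s) \<le> \<kappa>"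
  shows "Re (vip (cfgs N d) (\<phi> s1) (app (cfgs N d) (total_obs N a) (\<phi> s1)))
       - Re (vip (cfgs N d) (\<phi> s0) (app (cfgs N d) (total_obs N a) (\<phi> s0)))
     \<le> 2 * \<kappa> * (evolution.F (cfgs N d) Hc s1 - evolution.F (cfgs N d) Hc s0)"
proof (rule evolution.expectation_growth[OF ev hermitian_total_obs[OF a] s])
  fix s \<tau> assume s': "s \<in> {s0..s1}" and \<tau>: "\<tau> \<in> {0..<T}"
  from cp obtain m tt S h where tt: "tt 0 = 0" "tt m = T"
    and blk: "\<forall>j<m. \<forall>\<mu><nat \<lceil>real N / real k\<rceil>. S j \<mu> \<subseteq> {..<N} \<and> card (S j \<mu>) \<le> k
            \<and> (\<forall>t. hermitian_on (cf d (S j \<mu>)) (h j \<mu> t))"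
    and disj: "\<forall>j<m. \<forall>\<mu><nat \<lceil>real N / real k\<rceil>. \<forall>\<nu><nat \<lceil>real N / real k\<rceil>.
              \<mu> \<noteq> \<nu> \<longrightarrow> S j \<mu> \<inter> S j \<nu> = {}"
    and eq: "\<forall>j<m. \<forall>t. tt j \<le> t \<and> t < tt (Suc j) \<longrightarrow>
              eq_on (cfgs N d) (Hc t)
                (\<lambda>x y. \<Sum>\<mu><nat \<lceil>real N / real k\<rceil>. embed N (S j \<mu>) (h j \<mu> t) x y)"
    unfolding circuit_protocol_def by (elim conjE exE) (rule that)
  obtain j where j: "j < m" "tt j \<le> \<tau>" "\<tau> < tt (Suc j)"
    using partition_segment[of tt \<tau> m] \<tau> tt by auto
  show "Im (vip (cfgs N d) (app (cfgs N d) (total_obs N a) (\<phi> s)) (app (cfgs N d) (Hc \<tau>) (\<phi> s)))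
      \<le> \<kappa> * op_norm (cfgs N d) (Hc \<tau>)"
    unfolding total_obs_def
  proof (rule Im_vip_rate_le[where s="nat \<lceil>real N / real k\<rceil>" and S="S j" and h="\<lambda>\<mu>. h j \<mu> \<tau>" and \<beta>=\<beta> and k=k])
    show "hermitian_on (cf d {i}) (on_site i a)" for i by (rule hermitian_on_site[OF a])
    show "eq_on (cfgs N d) (Hc \<tau>) (\<lambda>x y. \<Sum>\<mu><nat \<lceil>real N / real k\<rceil>. embed N (S j \<mu>) (h j \<mu> \<tau>) x y)"
      using eq j by blast
    show "S j \<mu> \<subseteq> {..<N} \<and> card (S j \<mu>) \<le> k \<and> hermitian_on (cf d (S j \<mu>)) (h j \<mu> \<tau>)"
      if "\<mu> < nat \<lceil>real N / real k\<rceil>" for \<mu>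
      using blk j(1) that by blast
    show "S j \<mu> \<inter> S j \<nu> = {}" if "\<mu> < nat \<lceil>real N / real k\<rceil>" "\<nu> < nat \<lceil>real N / real k\<rceil>" "\<mu> \<noteq> \<nu>" for \<mu> \<nu>
      using disj j(1) that by blast
  qed (use d \<kappa>[OF s'] in auto)
qed

lemma vnorm_sum_on_site_le:
  assumes "0 < d" "R \<subseteq> {..<N}" "card R \<le> k"
  shows "vnorm (cfgs N d) (\<lambda>x. \<Sum>j\<in>R. app (cfgs N d) (embed N {j} (on_site j a)) \<phi> x)
    \<le> k * op_norm (batt d) a * vnorm (cfgs N d) \<phi>"
proof -
  have \<alpha>: "0 \<le> op_norm (batt d) a"
    by (rule op_norm_nonneg) (use assms in \<open>auto simp: batt_def lessThan_empty_iff\<close>)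
  have "vnorm (cfgs N d) (\<lambda>x. \<Sum>j\<in>R. app (cfgs N d) (embed N {j} (on_site j a)) \<phi> x)
      \<le> (\<Sum>j\<in>R. vnorm (cfgs N d) (app (cfgs N d) (embed N {j} (on_site j a)) \<phi>))"
    by (rule vnorm_sum_le)
  also have "\<dots> \<le> (\<Sum>j\<in>R. op_norm (batt d) a * vnorm (cfgs N d) \<phi>)"
    by (intro sum_mono vnorm_on_site_le) (use assms in auto)
  also have "\<dots> = card R * (op_norm (batt d) a * vnorm (cfgs N d) \<phi>)" by simp
  also have "\<dots> \<le> k * (op_norm (batt d) a * vnorm (cfgs N d) \<phi>)"
    by (intro mult_right_mono mult_nonneg_nonneg \<alpha>) (use assms in auto)
  finally show ?thesis by (simp add: mult.assoc)
qed

lemma circuit_expectation_growth_uniform: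
  assumes cp: "circuit_protocol d N k Hc T \<rho> \<sigma>" and d: "0 < d" and a: "hermitian_on (batt d) a"
    and ev: "evolution (cfgs N d) Hc T \<phi>" and s: "0 \<le> s0" "s0 \<le> s1" "s1 \<le> T"
  shows "Re (vip (cfgs N d) (\<phi> s1) (app (cfgs N d) (total_obs N a) (\<phi> s1)))
       - Re (vip (cfgs N d) (\<phi> s0) (app (cfgs N d) (total_obs N a) (\<phi> s0)))
     \<le> 2 * (k * op_norm (batt d) a * (vnorm (cfgs N d) (\<phi> 0))\<^sup>2)
         * (evolution.F (cfgs N d) Hc s1 - evolution.F (cfgs N d) Hc s0)"
proof (rule circuit_expectation_growth[OF cp d a ev s, where \<beta>="\<lambda>_. 0"])
  fix t R assume t: "t \<in> {s0..s1}" and R: "R \<subseteq> {..<N}" "card R \<le> k"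
  have c: "vnorm (cfgs N d) (\<phi> t) = vnorm (cfgs N d) (\<phi> 0)"
    by (rule evolution.vnorm_conserved[OF ev]) (use t s in auto)
  have "vnorm (cfgs N d) (\<lambda>x. \<Sum>j\<in>R. app (cfgs N d) (embed N {j} (on_site j a)) (\<phi> t) x) * vnorm (cfgs N d) (\<phi> t)
      \<le> (k * op_norm (batt d) a * vnorm (cfgs N d) (\<phi> t)) * vnorm (cfgs N d) (\<phi> t)"
    by (intro mult_right_mono vnorm_sum_on_site_le d R vnorm_nonneg)
  then show "vnorm (cfgs N d) (\<lambda>x. (\<Sum>j\<in>R. app (cfgs N d) (embed N {j} (on_site j a)) (\<phi> t) x)
        + of_real 0 * \<phi> t x) * vnorm (cfgs N d) (\<phi> t)
      \<le> k * op_norm (batt d) a * (vnorm (cfgs N d) (\<phi> 0))\<^sup>2"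
    by (simp add: c power2_eq_square mult.assoc)
qed

lemma cfgs_nonempty: "0 < d \<Longrightarrow> cfgs N d \<noteq> {}"
  unfolding cfgs_def by (rule cf_nonempty)

text \<open>The growth bound for each vector of the decomposition is proportional to its squared
  initial length, and these squares add up to the trace 1 of the initial product state.\<close>

lemma circuit_charge_le:
  assumes cp: "circuit_protocol d N k Hc T \<rho> \<sigma>" and d: "0 < d" and a: "hermitian_on (batt d) a"
    and \<rho>: "density_on (batt d) \<rho>" and \<sigma>: "density_on (batt d) \<sigma>"
  shows "real N * Re ((\<Sum>u<d. \<Sum>z<d. a u z * \<sigma> z u) - (\<Sum>u<d. \<Sum>z<d. a u z * \<rho> z u))
     \<le> 2 * (k * op_norm (batt d) a) * integral {0..T} (\<lambda>t. op_norm (cfgs N d) (Hc t))"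
proof -
  let ?B = "cfgs N d"
  have dr: "drives ?B Hc T (tensor_pow N \<rho>) (tensor_pow N \<sigma>)"
    using cp by (simp add: circuit_protocol_def)
  then have T: "0 \<le> T" by (simp add: drives_def)
  have tr: "(\<Sum>u<d. \<rho> u u) = 1" "(\<Sum>u<d. \<sigma> u u) = 1"
    using \<rho> \<sigma> by (simp_all add: density_on_def batt_def)
  have "\<exists>w. \<forall>x\<in>batt d. \<forall>y\<in>batt d. \<rho> x y = (\<Sum>b\<in>batt d. w b x * cnj (w b y))"
    by (rule psd_decomposition)
       (use \<rho> in \<open>auto simp: density_on_def vip_def app_def sum_distrib_left mult.assoc batt_def\<close>)
  then obtain w where w: "\<And>x y. x < d \<Longrightarrow> y < d \<Longrightarrow> \<rho> x y = (\<Sum>b<d. w b x * cnj (w b y))"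
    by (auto simp: batt_def)
  define W where "W f x = (\<Prod>i<N. w (f i) (x i))" for f x :: "nat \<Rightarrow> nat"
  have W: "tensor_pow N \<rho> x y = (\<Sum>f\<in>?B. W f x * cnj (W f y))" if "x \<in> ?B" "y \<in> ?B" for x y
    unfolding W_def by (rule tensor_pow_decomposition[OF w that])
  obtain \<phi> where ev: "\<And>f. f \<in> ?B \<Longrightarrow> evolution ?B Hc T (\<phi> f)"
    and init: "\<And>f x. x \<in> ?B \<Longrightarrow> \<phi> f 0 x = W f x"
    and final: "\<And>x y. x \<in> ?B \<Longrightarrow> y \<in> ?B \<Longrightarrow> tensor_pow N \<sigma> x y = (\<Sum>f\<in>?B. \<phi> f T x * cnj (\<phi> f T y))"
    using drives_imp_evolution[OF dr finite_cfgs cfgs_nonempty[OF d] W] by blast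
  have init': "tensor_pow N \<rho> x y = (\<Sum>f\<in>?B. \<phi> f 0 x * cnj (\<phi> f 0 y))" if "x \<in> ?B" "y \<in> ?B" for x y
    using W[OF that] init that by simp
  let ?g = "\<lambda>f t. Re (vip ?B (\<phi> f t) (app ?B (total_obs N a) (\<phi> f t)))"
  let ?F = "integral {0..T} (\<lambda>t. op_norm ?B (Hc t))"
  have step: "?g f T - ?g f 0 \<le> 2 * (k * op_norm (batt d) a) * ?F * (vnorm ?B (\<phi> f 0))\<^sup>2" if f: "f \<in> ?B" for f
    using circuit_expectation_growth_uniform[OF cp d a ev[OF f], of 0 T] T
    by (simp add: evolution.F_def[OF ev[OF f]] mult_ac)
  have "(\<Sum>f\<in>?B. ?g f T) = Re (of_nat N * (\<Sum>u<d. \<Sum>z<d. a u z * \<sigma> z u))"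
    using arg_cong[OF sum_vip_eq_trace[OF final, where A="total_obs N a"], where f=Re]
    by (simp only: Re_sum[symmetric] trace_total_obs[where \<tau>=\<sigma>, OF tr(2)])
  moreover have "(\<Sum>f\<in>?B. ?g f 0) = Re (of_nat N * (\<Sum>u<d. \<Sum>z<d. a u z * \<rho> z u))"
    using arg_cong[OF sum_vip_eq_trace[OF init', where A="total_obs N a"], where f=Re]
    by (simp only: Re_sum[symmetric] trace_total_obs[where \<tau>=\<rho>, OF tr(1)])
  moreover have "(\<Sum>f\<in>?B. (vnorm ?B (\<phi> f 0))\<^sup>2) = 1"
  proof -
    have "complex_of_real (\<Sum>f\<in>?B. (vnorm ?B (\<phi> f 0))\<^sup>2) = (\<Sum>f\<in>?B. \<Sum>x\<in>?B. \<phi> f 0 x * cnj (\<phi> f 0 x))"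
      unfolding of_real_sum vip_self[symmetric] vip_def by (simp add: mult.commute)
    also have "\<dots> = (\<Sum>x\<in>?B. tensor_pow N \<rho> x x)"
      by (subst sum.swap) (simp add: init')
    also have "\<dots> = 1" by (rule trace_tensor_pow[where \<tau>=\<rho>, OF tr(1)])
    finally show ?thesis by (simp only: of_real_eq_1_iff)
  qed
  moreover have "(\<Sum>f\<in>?B. ?g f T - ?g f 0) \<le> (\<Sum>f\<in>?B. 2 * (k * op_norm (batt d) a) * ?F * (vnorm ?B (\<phi> f 0))\<^sup>2)"
    by (intro sum_mono step)
  ultimately show ?thesis
    by (simp only: sum_subtractf sum_distrib_left[symmetric]) (simp add: right_diff_distrib)
qed

text \<open>The initial product state is an eigenvector of every summand of the observable, so the
charging power vanishes at the beginning; this makes the bound strict.\<close>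
lemma circuit_full_charge_less:
  assumes cp: "circuit_protocol d N k Hc T \<rho> \<sigma>" and d: "2 \<le> d" and N: "1 \<le> N" and k: "1 \<le> k"
    and \<rho>: "eq_on (batt d) \<rho> (proj 0)" and \<sigma>: "eq_on (batt d) \<sigma> (proj (d - 1))"
  shows "real N < k * integral {0..T} (\<lambda>t. op_norm (cfgs N d) (Hc t))"
proof -
  let ?B = "cfgs N d"
  let ?b = "batt d"
  define m where "m = d - 1"
  have m: "m \<noteq> 0" "m < d" "0 < d" using d by (auto simp: m_def)
  have fin: "finite ?b" "?b \<noteq> {}" using m by (auto simp: batt_def lessThan_empty_iff)
  define a :: "nat op" where "a = (\<lambda>x y. proj m x y - proj 0 x y)"
  have a: "hermitian_on ?b a" by (auto simp: hermitian_on_def a_def proj_def)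
  have a1: "op_norm ?b a \<le> 1"
  proof (rule op_norm_le[OF fin])
    fix v :: "nat \<Rightarrow> complex"
    have "app ?b a v x = (if x = m then v m else if x = 0 then - v 0 else 0)" for x
    proof -
      have "app ?b a v x = (\<Sum>y<d. (if y = m then if x = m then v m else 0 else 0) - (if y = 0 then if x = 0 then v 0 else 0 else 0))"
        unfolding app_def batt_def a_def by (intro sum.cong) (auto simp: proj_def)
      then show ?thesis using m by (simp add: sum_subtractf)
    qed
    then show "vnorm ?b (app ?b a v) \<le> 1 * vnorm ?b v"
      unfolding vnorm_def by (simp, intro L2_set_mono) auto
  qed
  have dr: "drives ?B Hc T (tensor_pow N \<rho>) (tensor_pow N \<sigma>)"
    using cp by (simp add: circuit_protocol_def)
  then have T: "0 \<le> T" by (simp add: drives_def)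
  have tr: "(\<Sum>u<d. proj l u u) = 1" and tra: "(\<Sum>u<d. \<Sum>z<d. a u z * proj l z u) = a l l" if "l < d" for l
  proof -
    show "(\<Sum>u<d. proj l u u) = 1" using that by (simp add: proj_def)
    have "(\<Sum>u<d. \<Sum>z<d. a u z * proj l z u) = (\<Sum>u<d. \<Sum>z<d. if z = l then if u = l then a l l else 0 else 0)"
      by (intro sum.cong) (auto simp: proj_def)
    then show "(\<Sum>u<d. \<Sum>z<d. a u z * proj l z u) = a l l" using that by simp
  qed
  have tp: "tensor_pow N \<tau> x y = tensor_pow N (proj l) x y" if "eq_on ?b \<tau> (proj l)" "x \<in> ?B" "y \<in> ?B" for \<tau> l x y
    unfolding tensor_pow_def
    by (rule prod.cong) (use that in \<open>auto simp: eq_on_def batt_def cfgs_def PiE_iff\<close>)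
  \<comment> \<open>The initial state is pure, so one vector suffices: the basis vector of the
    all-ground configuration, with the one-point index set \<open>{()}\<close>.\<close>
  define w :: "(nat \<Rightarrow> nat) \<Rightarrow> complex" where "w x = (if \<forall>i<N. x i = 0 then 1 else 0)" for x
  have W: "tensor_pow N \<rho> x y = (\<Sum>f\<in>{()}. w x * cnj (w y))" if "x \<in> ?B" "y \<in> ?B" for x y
  proof (cases "(\<forall>i<N. x i = 0) \<and> (\<forall>i<N. y i = 0)")
    case True
    then show ?thesis unfolding tp[OF \<rho> that] by (simp add: tensor_pow_def proj_def w_def)
  next
    case False
    then obtain i where "i < N" "proj 0 (x i) (y i) = 0" by (auto simp: proj_def)
    then have "tensor_pow N (proj 0) x y = 0" unfolding tensor_pow_def by (intro prod_zero) auto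
    then show ?thesis unfolding tp[OF \<rho> that] using False by (auto simp: w_def)
  qed
  obtain \<phi>' where ev': "\<And>f. f \<in> {()} \<Longrightarrow> evolution ?B Hc T (\<phi>' f)"
    and init': "\<And>f x. x \<in> ?B \<Longrightarrow> \<phi>' f 0 x = w x"
    and final': "\<And>x y. x \<in> ?B \<Longrightarrow> y \<in> ?B \<Longrightarrow> tensor_pow N \<sigma> x y = (\<Sum>f\<in>{()}. \<phi>' f T x * cnj (\<phi>' f T y))"
    using drives_imp_evolution[OF dr finite_cfgs cfgs_nonempty[OF m(3)], where I="{()}" and w="\<lambda>_. w"] W by blast
  define \<phi> where "\<phi> = \<phi>' ()"
  have init: "\<phi> 0 x = w x" if "x \<in> ?B" for x using init' that by (simp add: \<phi>_def)
  interpret evolution ?B Hc T \<phi> using ev' by (simp add: \<phi>_def)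
  let ?g = "\<lambda>t. Re (vip ?B (\<phi> t) (app ?B (total_obs N a) (\<phi> t)))"
  have gT: "?g T = N"
  proof -
    have "tensor_pow N (proj m) x y = (\<Sum>f\<in>{()}. \<phi> T x * cnj (\<phi> T y))" if "x \<in> ?B" "y \<in> ?B" for x y
      using final'[OF that] tp[OF \<sigma> that] by (simp add: \<phi>_def m_def)
    from sum_vip_eq_trace[OF this, where A="total_obs N a"]
    show ?thesis using m by (simp add: trace_total_obs[where \<tau>="proj m", OF tr[OF m(2)]] tra) (simp add: a_def proj_def)
  qed
  have g0: "?g 0 = - real N"
  proof -
    have "tensor_pow N (proj 0) x y = (\<Sum>f\<in>{()}. \<phi> 0 x * cnj (\<phi> 0 y))" if "x \<in> ?B" "y \<in> ?B" for x y
      using W[OF that] tp[OF \<rho> that] init that by simp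
    from sum_vip_eq_trace[OF this, where A="total_obs N a"]
    show ?thesis using m by (simp add: trace_total_obs[where \<tau>="proj 0", OF tr[OF m(3)]] tra) (simp add: a_def proj_def)
  qed
  have n0: "vnorm ?B (\<phi> 0) = 1"
  proof -
    have "complex_of_real ((vnorm ?B (\<phi> 0))\<^sup>2) = (\<Sum>x\<in>?B. tensor_pow N (proj 0) x x)"
      unfolding vip_self[symmetric] vip_def
      by (intro sum.cong refl) (use W tp[OF \<rho>] init in \<open>simp add: mult.commute\<close>)
    also have "\<dots> = 1" by (rule trace_tensor_pow[where \<tau>="proj 0", OF tr[OF m(3)]])
    finally have "(vnorm ?B (\<phi> 0))\<^sup>2 = 1" by (simp only: of_real_eq_1_iff)
    then show ?thesis using vnorm_nonneg[of ?B "\<phi> 0"] by (simp add: power2_eq_1_iff)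
  qed
  have n1: "vnorm ?B (\<phi> t) = 1" if "t \<in> {0..T}" for t using vnorm_conserved[OF that] n0 by simp
  have late: "?g s1 - ?g s0 \<le> 2 * k * (F s1 - F s0)" if s: "0 \<le> s0" "s0 \<le> s1" "s1 \<le> T" for s0 s1
  proof -
    have "?g s1 - ?g s0 \<le> 2 * (k * op_norm ?b a * (vnorm ?B (\<phi> 0))\<^sup>2) * (F s1 - F s0)"
      by (rule circuit_expectation_growth_uniform[OF cp m(3) a evolution_axioms s])
    also have "\<dots> \<le> 2 * (k * 1) * (F s1 - F s0)"
      using mult_left_mono[OF a1, of "real k"] F_mono[OF s] by (intro mult_right_mono) (auto simp: n0)
    finally show ?thesis by simp
  qed
  have FT: "F T > 0"
  proof -
    have "0 < k * F T" using late[of 0 T] T gT g0 N by simp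
    then show ?thesis by (simp add: zero_less_mult_iff)
  qed
  define c where "c = real (card ?B)"
  have c: "c > 0" using cfgs_nonempty[OF m(3), of N] by (simp add: c_def card_gt_0_iff)
  \<comment> \<open>As long as the accumulated norm is at most \<open>\<delta>\<close>, the vector
    has moved by at most \<open>c * \<delta>\<close>. The bound 1/(4c) keeps the lengths below at
    k/2, half of the general value; the minimum with \<open>F T\<close> makes
    \<open>\<delta>\<close> a value of \<open>F\<close>.\<close>
  define \<delta> where "\<delta> = min (F T) (1 / (4 * c))"
  have \<delta>: "\<delta> > 0" "\<delta> \<le> F T" "2 * c * \<delta> \<le> 1 / 2"
    using FT c by (auto simp: \<delta>_def min_def field_simps)
  obtain t1 where t1: "0 \<le> t1" "t1 \<le> T" "F t1 = \<delta>"
    using IVT'[of F 0 \<delta> T] \<delta> T F_cont by auto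
  \<comment> \<open>All copies of \<open>a\<close> have eigenvalue -1 on the initial vector, so the
    shift by \<open>card R\<close> makes the operator annihilate it and only the displacement
    \<open>\<eta>\<close> counts.\<close>
  have early: "?g t1 - ?g 0 \<le> 2 * (k / 2) * (F t1 - F 0)"
  proof (rule circuit_expectation_growth[OF cp m(3) a evolution_axioms order_refl t1(1,2), where \<beta>="\<lambda>R. real (card R)"])
    fix s R assume s: "s \<in> {0..t1}" and R: "R \<subseteq> {..<N}" "card R \<le> k"
    let ?A = "\<lambda>j. app ?B (embed N {j} (on_site j a))"
    define \<eta> where "\<eta> x = \<phi> s x - \<phi> 0 x" for x
    have \<eta>: "vnorm ?B \<eta> \<le> c * \<delta>"
    proof -
      have "vnorm ?B \<eta> \<le> card ?B * (1 * (F s - F 0))"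
        unfolding \<eta>_def by (rule vnorm_increment_le) (use n1 s t1 in auto)
      also have "\<dots> \<le> c * \<delta>" using F_mono[of s t1] s t1 c by (simp add: c_def)
      finally show ?thesis .
    qed
    have eig: "?A j (\<phi> 0) x = - \<phi> 0 x" if j: "j < N" and x: "x \<in> ?B" for j x
    proof -
      have "?A j (\<phi> 0) x = ?A j w x" by (rule app_cong) (auto simp: init)
      also have "\<dots> = (\<Sum>z<d. a (x j) z * w (override_on x (restrict (\<lambda>_. z) {j}) {j}))"
        using j x by (simp add: app_embed sum_cf_singleton on_site_def)
      also have "\<dots> = (\<Sum>z<d. if z = 0 then - w x else 0)"
      proof (intro sum.cong refl)
        fix z
        show "a (x j) z * w (override_on x (restrict (\<lambda>_. z) {j}) {j}) = (if z = 0 then - w x else 0)"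
        proof (cases "z = 0")
          case False
          then have "w (override_on x (restrict (\<lambda>_. z) {j}) {j}) = 0"
            using j by (auto simp: w_def override_on_def)
          with False show ?thesis by simp
        next
          case True
          show ?thesis
          proof (cases "x j = 0")
            case xj: True
            then have "override_on x (restrict (\<lambda>_. z) {j}) {j} = x"
              using True by (auto simp: override_on_def)
            then show ?thesis using True xj m by (simp add: a_def proj_def)
          next
            case xj: False
            then have "w x = 0" using j by (auto simp: w_def)
            then show ?thesis using True xj m by (simp add: a_def proj_def)
          qed
        qed
      qed
      also have "\<dots> = - w x" using m by simp
      finally show ?thesis using init[OF x] by simp
    qed
    have \<phi>s: "\<phi> s = (\<lambda>x. \<phi> 0 x + \<eta> x)" by (simp add: \<eta>_def)
    have "vnorm ?B (\<lambda>x. (\<Sum>j\<in>R. ?A j (\<phi> s) x) + of_real (real (card R)) * \<phi> s x)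
        = vnorm ?B (\<lambda>x. (\<Sum>j\<in>R. ?A j \<eta> x) + of_nat (card R) * \<eta> x)"
    proof (rule vnorm_cong)
      fix x assume x: "x \<in> ?B"
      have "(\<Sum>j\<in>R. ?A j (\<phi> s) x) = (\<Sum>j\<in>R. - \<phi> 0 x + ?A j \<eta> x)"
        unfolding \<phi>s app_add by (intro sum.cong refl) (use eig x R in auto)
      also have "\<dots> = - (of_nat (card R) * \<phi> 0 x) + (\<Sum>j\<in>R. ?A j \<eta> x)" by (simp add: sum_subtractf)
      finally show "(\<Sum>j\<in>R. ?A j (\<phi> s) x) + of_real (real (card R)) * \<phi> s x
          = (\<Sum>j\<in>R. ?A j \<eta> x) + of_nat (card R) * \<eta> x"
        by (simp add: \<eta>_def algebra_simps)
    qed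
    also have "\<dots> \<le> vnorm ?B (\<lambda>x. \<Sum>j\<in>R. ?A j \<eta> x) + vnorm ?B (\<lambda>x. of_nat (card R) * \<eta> x)"
      by (rule vnorm_add_le)
    also have "\<dots> \<le> k * vnorm ?B \<eta> + k * vnorm ?B \<eta>"
    proof (rule add_mono)
      have "vnorm ?B (\<lambda>x. \<Sum>j\<in>R. ?A j \<eta> x) \<le> k * op_norm ?b a * vnorm ?B \<eta>"
        by (rule vnorm_sum_on_site_le[OF m(3) R])
      also have "\<dots> \<le> k * 1 * vnorm ?B \<eta>"
        using mult_left_mono[OF a1, of "real k"] by (intro mult_right_mono) auto
      finally show "vnorm ?B (\<lambda>x. \<Sum>j\<in>R. ?A j \<eta> x) \<le> k * vnorm ?B \<eta>" by simp
      show "vnorm ?B (\<lambda>x. of_nat (card R) * \<eta> x) \<le> k * vnorm ?B \<eta>"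
        unfolding vnorm_scale using R by (auto intro: mult_right_mono)
    qed
    also have "\<dots> = 2 * k * vnorm ?B \<eta>" by simp
    also have "\<dots> \<le> 2 * k * (c * \<delta>)" by (intro mult_left_mono \<eta>) auto
    also have "\<dots> = k * (2 * c * \<delta>)" by simp
    also have "\<dots> \<le> k * (1 / 2)" by (intro mult_left_mono \<delta>) auto
    finally show "vnorm ?B (\<lambda>x. (\<Sum>j\<in>R. ?A j (\<phi> s) x) + of_real (real (card R)) * \<phi> s x) * vnorm ?B (\<phi> s) \<le> k / 2"
      using n1[of s] s t1 by simp
  qed
  \<comment> \<open>The expectation must rise from -N to N. The first stretch, of norm
    \<open>\<delta>\<close>, is charged at half the general rate, which leaves a deficit of
    \<open>k * \<delta>\<close>.\<close>
  have "2 * real N \<le> k * \<delta> + 2 * k * (F T - \<delta>)"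
    using early late[OF t1(1,2) order_refl] gT g0 t1(3) by simp
  also have "\<dots> < 2 * k * F T" using \<delta>(1) k by (simp add: algebra_simps)
  finally show ?thesis by (simp add: F_def)
qed

section \<open>From (C0) to the bound on the advantage\<close>

lemma C0_imp_integral_le:
  assumes "optimal_single d \<rho> \<sigma> E H Tp" "C0 d N Hc Ts H Tp" "0 < Tp" "0 < Ts"
  shows "integral {0..Ts} (\<lambda>t. op_norm (cfgs N d) (Hc t)) \<le> real N * E * Ts"
proof -
  have "integral {0..Tp} (\<lambda>t. op_norm (batt d) (H t)) \<le> integral {0..Tp} (\<lambda>_. E)"
    using assms(1) by (intro integral_le) (auto simp: optimal_single_def drives_def)
  then have "integral {0..Tp} (\<lambda>t. op_norm (batt d) (H t)) \<le> E * Tp"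
    using assms(3) by (simp add: mult.commute)
  then have "(1 / Tp) * integral {0..Tp} (\<lambda>t. op_norm (batt d) (H t)) \<le> E"
    using assms(3) by (simp add: field_simps)
  then have "real N * ((1 / Tp) * integral {0..Tp} (\<lambda>t. op_norm (batt d) (H t))) \<le> real N * E"
    by (rule mult_left_mono) simp
  with assms(2) have "(1 / Ts) * integral {0..Ts} (\<lambda>t. op_norm (cfgs N d) (Hc t)) \<le> real N * E"
    unfolding C0_def by linarith
  then show ?thesis using assms(4) by (simp add: field_simps)
qed

text \<open>A protocol of duration zero already connects equal states and competes with the optimal
  one.\<close>

lemma optimal_time_zero:
  assumes "optimal_single d \<rho> \<sigma> E H Tp" "0 < d" "0 < E" "eq_on (batt d) \<rho> \<sigma>"
  shows "Tp \<le> 0"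
proof -
  have fin: "finite (batt d)" "batt d \<noteq> {}" using assms(2) by (auto simp: batt_def lessThan_empty_iff)
  have "drives (batt d) (\<lambda>_ _ _. 0) 0 \<rho> \<sigma>"
    unfolding drives_def
  proof (intro conjI exI[of _ "\<lambda>_. op_id"])
    show "solves_schroedinger (batt d) (\<lambda>_ _ _. 0) 0 (\<lambda>_. op_id)"
      by (simp add: solves_schroedinger_def op_mult_def integrable_0)
    have "op_mult (batt d) (op_mult (batt d) op_id \<rho>) (op_adj op_id) x y = \<rho> x y"
      if "x \<in> batt d" "y \<in> batt d" for x y
    proof -
      have "op_mult (batt d) op_id \<rho> x z = \<rho> x z" for z
        using app_id[OF fin(1) that(1), of "\<lambda>w. \<rho> w z"] by (simp add: op_mult_def app_def)
      then have "op_mult (batt d) (op_mult (batt d) op_id \<rho>) (op_adj op_id) x y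
          = (\<Sum>z\<in>batt d. op_id y z * \<rho> x z)"
        unfolding op_mult_def[of _ "op_mult (batt d) op_id \<rho>"] op_adj_def
        by (intro sum.cong) (auto simp: op_id_def)
      then show ?thesis using app_id[OF fin(1) that(2), of "\<rho> x"] by (simp add: app_def)
    qed
    then show "eq_on (batt d) \<sigma> (op_mult (batt d) (op_mult (batt d) op_id \<rho>) (op_adj op_id))"
      using assms(4) by (simp add: eq_on_def)
    show "(\<lambda>t::real. op_norm (batt d) (\<lambda>_ _. 0)) integrable_on {0..0}" by (rule integrable_const_ivl)
  qed (auto simp: hermitian_on_def)
  moreover have "op_norm (batt d) (\<lambda>_ _. 0) \<le> E"
    by (rule op_norm_le[OF fin]) (use assms(3) in \<open>simp add: app_def vnorm_def L2_set_def sum_nonneg\<close>)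
  ultimately show ?thesis using assms(1) unfolding optimal_single_def by blast
qed

theorem theorem1:
  fixes d :: nat and lam :: "nat \<Rightarrow> real" and \<rho> \<sigma> :: "nat op"
    and E :: real and H :: "real \<Rightarrow> nat op" and Tp :: real
  assumes "2 \<le> d"
    and "\<forall>l. Suc l < d \<longrightarrow> lam l < lam (Suc l)"
    and "lam (d - 1) - lam 0 = 2 * lam (d - 1)" and "0 < lam (d - 1)"
    and "density_on (batt d) \<rho>" and "density_on (batt d) \<sigma>"
    and "0 < E"
    and "optimal_single d \<rho> \<sigma> E H Tp"
  shows "(\<exists>\<gamma>. advantage_bounded d \<rho> \<sigma> H Tp \<gamma>)
       \<and> (eq_on (batt d) \<rho> (proj 0) \<and> eq_on (batt d) \<sigma> (proj (d - 1))
           \<longrightarrow> advantage_bounded d \<rho> \<sigma> H Tp (pi / 2))"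
proof -
  note \<rho> = assms(5) and \<sigma> = assms(6) and E = assms(7) and opt = assms(8)
  have d: "0 < d" using assms(1) by simp
  have Tp0: "0 \<le> Tp" using opt by (simp add: optimal_single_def drives_def)
  have Ts0: "0 \<le> Ts" if "circuit_protocol d N k Hc Ts \<rho> \<sigma>" for N k Hc Ts
    using that by (simp add: circuit_protocol_def drives_def)
  have bounded: "advantage_bounded d \<rho> \<sigma> H Tp \<gamma>"
    if \<gamma>: "0 < \<gamma>" and main: "\<And>N k Hc Ts. 1 \<le> N \<Longrightarrow> 1 \<le> k \<Longrightarrow> circuit_protocol d N k Hc Ts \<rho> \<sigma> \<Longrightarrow>
      0 < Tp \<Longrightarrow> 0 < Ts \<Longrightarrow> integral {0..Ts} (\<lambda>t. op_norm (cfgs N d) (Hc t)) \<le> real N * E * Ts \<Longrightarrow>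
      Tp / Ts < \<gamma> * real k" for \<gamma>
    unfolding advantage_bounded_def
  proof (intro allI impI)
    fix N k Hc Ts
    assume *: "1 \<le> N" "1 \<le> (k::nat)" "circuit_protocol d N k Hc Ts \<rho> \<sigma>" "C0 d N Hc Ts H Tp"
    show "Tp / Ts < \<gamma> * real k"
    proof (cases "Tp = 0 \<or> Ts = 0")
      case True
      \<comment> \<open>If \<open>Ts = 0\<close>, the quotient is 0 by the convention for division
        by zero, so positivity of \<open>\<gamma>\<close> is enough.\<close>
      then show ?thesis using \<gamma> *(2) by auto
    next
      case False
      with Tp0 Ts0[OF *(3)] have "0 < Tp" "0 < Ts" by auto
      then show ?thesis using main[OF *(1-3)] C0_imp_integral_le[OF opt *(4)] by blast
    qed
  qed
  have "\<exists>\<gamma>. advantage_bounded d \<rho> \<sigma> H Tp \<gamma>"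
  proof (cases "eq_on (batt d) \<rho> \<sigma>")
    case True
    then have "Tp \<le> 0" using optimal_time_zero[OF opt d E] by blast
    \<comment> \<open>With \<open>Tp \<le> 0\<close> the condition \<open>0 < Tp\<close> of
      \<open>bounded\<close> fails, so any positive constant will do.\<close>
    then show ?thesis by (intro exI[of _ 1] bounded) auto
  next
    case False
    define a where "a = (\<lambda>x y. \<sigma> x y - \<rho> x y)"
    define \<alpha> where "\<alpha> = op_norm (batt d) a"
    \<comment> \<open>The squared Hilbert-Schmidt norm of \<open>a\<close>, which equals the charge
      of one battery measured by \<open>a\<close>.\<close>
    define w where "w = (\<Sum>u<d. \<Sum>z<d. (cmod (a u z))\<^sup>2)"
    have her: "\<rho> x y = cnj (\<rho> y x)" "\<sigma> x y = cnj (\<sigma> y x)" if "x < d" "y < d" for x y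
      using \<rho> \<sigma> that unfolding density_on_def hermitian_on_def batt_def by blast+
    have a: "hermitian_on (batt d) a"
      unfolding hermitian_on_def
    proof (intro ballI)
      fix x y assume "x \<in> batt d" "y \<in> batt d"
      then show "a x y = cnj (a y x)" using her[of x y] by (simp add: a_def batt_def)
    qed
    have \<alpha>: "0 \<le> \<alpha>" unfolding \<alpha>_def
      by (rule op_norm_nonneg) (use d in \<open>auto simp: batt_def lessThan_empty_iff\<close>)
    have w: "(\<Sum>u<d. \<Sum>z<d. a u z * \<sigma> z u) - (\<Sum>u<d. \<Sum>z<d. a u z * \<rho> z u) = of_real w"
    proof -
      have "(\<Sum>u<d. \<Sum>z<d. a u z * \<sigma> z u) - (\<Sum>u<d. \<Sum>z<d. a u z * \<rho> z u) = (\<Sum>u<d. \<Sum>z<d. a u z * a z u)"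
        by (simp add: a_def right_diff_distrib sum_subtractf)
      also have "\<dots> = (\<Sum>u<d. \<Sum>z<d. of_real ((cmod (a u z))\<^sup>2))"
      proof (intro sum.cong refl)
        fix u z assume "u \<in> {..<d}" "z \<in> {..<d}"
        then have "a z u = cnj (a u z)" using a unfolding hermitian_on_def batt_def by blast
        then show "a u z * a z u = of_real ((cmod (a u z))\<^sup>2)" by (simp only: complex_norm_square)
      qed
      finally show ?thesis by (simp add: w_def)
    qed
    have w0: "0 < w"
    proof -
      obtain u z where uz: "u < d" "z < d" "a u z \<noteq> 0"
        using False by (auto simp: eq_on_def batt_def a_def)
      have "0 < (cmod (a u z))\<^sup>2" using uz by simp
      also have "\<dots> \<le> (\<Sum>z<d. (cmod (a u z))\<^sup>2)" by (rule member_le_sum) (use uz in auto)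
      also have "\<dots> \<le> w" unfolding w_def
        by (rule member_le_sum[where f="\<lambda>u. \<Sum>z<d. (cmod (a u z))\<^sup>2"]) (use uz in \<open>auto intro: sum_nonneg\<close>)
      finally show ?thesis .
    qed
    \<comment> \<open>The charge bound with (C0) gives
      \<open>w \<le> 2 * k * \<alpha> * E * Ts\<close>; solving for \<open>Tp / Ts\<close> yields
      the quotient, and the added 1 makes the inequality strict. Only single-battery quantities
      occur.\<close>
    have "advantage_bounded d \<rho> \<sigma> H Tp (2 * \<alpha> * E * Tp / w + 1)"
    proof (rule bounded)
      show "0 < 2 * \<alpha> * E * Tp / w + 1"
        using \<alpha> E Tp0 w0 by (intro add_nonneg_pos divide_nonneg_pos mult_nonneg_nonneg) auto
      fix N k Hc Ts
      assume N: "1 \<le> N" and k: "1 \<le> (k::nat)" and cp: "circuit_protocol d N k Hc Ts \<rho> \<sigma>" and Tp: "0 < Tp" and Ts: "0 < Ts"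
        and F: "integral {0..Ts} (\<lambda>t. op_norm (cfgs N d) (Hc t)) \<le> real N * E * Ts"
      have "real N * w \<le> 2 * (k * \<alpha>) * integral {0..Ts} (\<lambda>t. op_norm (cfgs N d) (Hc t))"
        using circuit_charge_le[OF cp d a \<rho> \<sigma>] unfolding w \<alpha>_def by simp
      also have "\<dots> \<le> 2 * (k * \<alpha>) * (real N * E * Ts)"
        using \<alpha> by (intro mult_left_mono F) auto
      finally have "real N * w \<le> real N * (2 * k * \<alpha> * E * Ts)" by (simp add: mult_ac)
      then have "w \<le> 2 * k * \<alpha> * E * Ts" using N by simp
      then have "w * Tp \<le> 2 * k * \<alpha> * E * Ts * Tp" using Tp by (intro mult_right_mono) auto
      then have "Tp / Ts \<le> 2 * \<alpha> * E * Tp / w * k" using Ts w0 by (simp add: field_simps)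
      also have "\<dots> < (2 * \<alpha> * E * Tp / w + 1) * k" using k by (simp add: algebra_simps)
      finally show "Tp / Ts < (2 * \<alpha> * E * Tp / w + 1) * k" .
    qed
    then show ?thesis by blast
  qed
  moreover have "advantage_bounded d \<rho> \<sigma> H Tp (pi / 2)"
    if pr: "eq_on (batt d) \<rho> (proj 0)" "eq_on (batt d) \<sigma> (proj (d - 1))"
  proof (rule bounded)
    fix N k Hc Ts
    assume N: "1 \<le> N" and k: "1 \<le> (k::nat)" and cp: "circuit_protocol d N k Hc Ts \<rho> \<sigma>" and Tp: "0 < Tp" and Ts: "0 < Ts"
      and F: "integral {0..Ts} (\<lambda>t. op_norm (cfgs N d) (Hc t)) \<le> real N * E * Ts"
    have "real N < k * integral {0..Ts} (\<lambda>t. op_norm (cfgs N d) (Hc t))"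
      by (rule circuit_full_charge_less[OF cp assms(1) N k pr])
    also have "\<dots> \<le> k * (real N * E * Ts)" by (intro mult_left_mono F) auto
    finally have "real N * 1 < real N * (k * E * Ts)" by (simp add: mult_ac)
    then have "1 < k * E * Ts" using N by simp
    \<comment> \<open>Multiplying by \<open>Tp\<close> brings in the product \<open>E * Tp\<close>,
      which the rotation bounds by pi/2 whatever \<open>E\<close> is.\<close>
    then have "Tp < k * E * Ts * Tp" using Tp by simp
    then have "Tp / Ts < k * (E * Tp)" using Ts by (simp add: field_simps)
    also have "\<dots> \<le> k * (pi / 2)"
      using optimal_time_le[OF opt assms(1) E pr] E by (intro mult_left_mono) (simp_all add: field_simps)
    finally show "Tp / Ts < pi / 2 * k" by (simp add: mult.commute)
  qed simp
  ultimately show ?thesis by blast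
qed

end
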